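(* Let $\delta=d/dx$ and let $\sigma$ be the shift $\sigma(f)(x)=f(x+1)$. (1) Let $f$ be a meromorphic function on some horizontal strip $\{x\in\mathbb{C}\mid m<\operatorname{Im}x<M\}$, $m<M$, satisfying a linear differential equation and a linear difference equation $$\delta^{n}(f)+a_{n-1}\delta^{n-1}(f)+\dots+a_0f=0,\qquad \sigma^{l}(f)+b_{l-1}\sigma^{l-1}(f)+\dots+b_0f=0$$ with $a_i,b_i\in\mathbb{C}(x)$. Then $$f(x)=\sum_{i=1}^t r_i(x)e^{\alpha_i x}$$ for some $t$, $\alpha_i\in\mathbb{C}$ and $r_i\in\mathbb{C}(x)$. Conversely, any function $f(x)=\sum_{i=1}^t r_i(x)e^{\alpha_i x}$ with $\alpha_i\in\mathbb{C}$ and $r_i\in\mathbb{C}(x)$ satisfies a pair consisting of a linear differential equation $\delta^{n}(f)+a_{n-1}\delta^{n-1}(f)+\dots+a_0f=0$ and a linear difference equation $\sigma^{l}(f)+b_{l-1}\sigma^{l-1}(f)+\dots+b_0f=0$, for some positive integers $n,l$ and with coefficients $a_i,b_i\in\mathbb{C}(x)$. (2) If $f\in\mathbb{C}[[x^{-1}]][x]$ satisfies a linear differential equation $\delta^{n}(f)+a_{n-1}\delta^{n-1}(f)+\dots+a_0f=0$ and a linear difference equation $\sigma^{l}(f)+b_{l-1}\sigma^{l-1}(f)+\dots+b_0f=0$ with $a_i,b_i\in\mathbb{C}(x)$, then $f$ is rational, i.e. $f\in\mathbb{C}(x)$.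
   Context: $\mathbb{C}[[x^{-1}]][x]$ is the field of formal Laurent series in $x^{-1}$; $\mathbb{C}(x)$ is considered as a subfield of it via series expansion at $x=\infty$. The operators $\delta=d/dx$ and $\sigma: x\mapsto x+1$ act on it in the obvious way (re-expanding $(x+1)^{-j}$ in powers of $x^{-1}$). *)

theory Defs
  imports
    "HOL-Complex_Analysis.Complex_Analysis"
    "HOL-Computational_Algebra.Computational_Algebra"
    "HOL-Computational_Algebra.Field_as_Ring"
begin

type_synonym ratfun = "complex poly fract"


section \<open>Meromorphic functions\<close>

text \<open>
  The values of a function that is \<^const>\<open>meromorphic_on\<close> \<open>A\<close> may be arbitrary on a set that is
  sparse in \<open>A\<close> (for instance at the poles).  Accordingly, equality of meromorphic functions on
  \<open>A\<close> is equality for all points of \<open>A\<close> outside such a set, written \<open>\<forall>\<^sub>\<approx>x\<in>A\<close>.  At all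
  points outside such a set, the iterates of \<^const>\<open>deriv\<close> are the true derivatives.

  A rational function is evaluated through its representation in lowest terms, so the value is
  the expected one away from the poles of \<open>r\<close>; at a pole it is \<open>0\<close>.
\<close>

definition ratfun_eval :: "ratfun \<Rightarrow> complex \<Rightarrow> complex" where
  "ratfun_eval r z = poly (fst (quot_of_fract r)) z / poly (snd (quot_of_fract r)) z"

definition fun_shift :: "(complex \<Rightarrow> complex) \<Rightarrow> complex \<Rightarrow> complex" where
  "fun_shift f = (\<lambda>z. f (z + 1))"

definition horizontal_strip :: "real \<Rightarrow> real \<Rightarrow> complex set" where
  "horizontal_strip m M = {z. m < Im z \<and> Im z < M}"

lemma ratfun_eval_Fract:
  assumes "poly q z \<noteq> 0"
  shows "ratfun_eval (Fract p q) z = poly p z / poly q z"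
proof -
  have q: "q \<noteq> 0"
    using assms by auto
  define u v where "u = fst (quot_of_fract (Fract p q))" and "v = snd (quot_of_fract (Fract p q))"
  have v: "v \<noteq> 0"
    by (simp add: v_def)
  have "Fract u v = Fract p q"
    unfolding u_def v_def by (rule Fract_quot_of_fract)
  hence eq: "u * q = p * v"
    using q v by (simp add: eq_fract)
  have "coprime u v"
    unfolding u_def v_def by (rule coprime_quot_of_fract)
  with eq have "v dvd q"
    by (metis coprime_commute coprime_dvd_mult_right_iff dvd_triv_right)
  with assms have "poly v z \<noteq> 0"
    by (auto elim!: dvdE)
  moreover have "poly u z * poly q z = poly p z * poly v z"
    using arg_cong[OF eq, of "\<lambda>f. poly f z"] by simp
  ultimately show ?thesis
    using assms by (simp add: ratfun_eval_def u_def v_def field_simps)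
qed


section \<open>Formal Laurent series in the reciprocal of x\<close>

text \<open>
  The field of formal Laurent series in \<open>1 / x\<close> is represented by the type of formal Laurent
  series over the complex numbers, where \<^const>\<open>fls_X\<close> stands for \<open>1 / x\<close>.  Consequently
  \<open>x\<close> is \<^const>\<open>fls_X_inv\<close>, and the coefficient with index \<open>k\<close> is that of the power
  \<open>-k\<close> of \<open>x\<close>.
\<close>

definition poly_expansion :: "complex poly \<Rightarrow> complex fls" where
  "poly_expansion p = poly (map_poly fls_const p) fls_X_inv"

definition ratfun_expansion :: "ratfun \<Rightarrow> complex fls" where
  "ratfun_expansion r =
     poly_expansion (fst (quot_of_fract r)) / poly_expansion (snd (quot_of_fract r))"

text \<open>With \<open>t = 1 / x\<close>, the chain rule gives \<open>d/dx = - t\<^sup>2 d/dt\<close>.\<close>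

definition fls_delta :: "complex fls \<Rightarrow> complex fls" where
  "fls_delta f = - (fls_X ^ 2 * fls_deriv f)"

text \<open>With \<open>t = 1 / x\<close>, one has \<open>1 / (x + 1) = t / (1 + t)\<close>.\<close>

definition fls_sigma :: "complex fls \<Rightarrow> complex fls" where
  "fls_sigma f = fls_compose_fps f (fps_X / (1 + fps_X))"

lemma fls_delta_nth:
  includes fps_syntax
  shows "fls_delta f $$ n = - of_int (n - 1) * f $$ (n - 1)"
  by (simp add: fls_delta_def fls_X_power_times_conv_shift algebra_simps)

lemma fls_delta_x: "fls_delta fls_X_inv = 1"
  by (rule fls_eqI) (auto simp: fls_delta_nth)

lemma fls_sigma_x: "fls_sigma fls_X_inv = fls_X_inv + 1"
proof -
  define G where "G = (fps_X / (1 + fps_X) :: complex fps)"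
  have G: "G * (1 + fps_X) = fps_X"
    unfolding G_def by (subst fps_divide_unit) (simp_all add: mult.assoc inverse_mult_eq_1)
  hence "fps_nth (G * (1 + fps_X)) 0 = 0"
    by simp
  hence G0: "fps_nth G 0 = 0"
    by simp
  have X: "fls_X * fls_X_inv = (1 :: complex fls)"
    by (simp flip: fls_inverse_X)
  have "fps_to_fls G * (1 + fls_X) = fls_X"
    using arg_cong[OF G, of fps_to_fls] by (simp add: fls_times_fps_to_fls)
  hence "fps_to_fls G * ((1 + fls_X) * fls_X_inv) = 1"
    by (simp add: X flip: mult.assoc)
  hence *: "fps_to_fls G * (fls_X_inv + 1) = 1"
    by (simp only: distrib_right X mult_1_left)
  have "G \<noteq> 0"
    using G by auto
  hence "fls_sigma fls_X_inv = inverse (fps_to_fls G)"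
    using G0 fls_compose_fps_inverse[of G fls_X] fls_compose_fps_to_fls[of G fps_X]
    by (simp add: fls_sigma_def fls_inverse_X flip: G_def)
  thus ?thesis
    using * inverse_unique by metis
qed

lemma poly_expansion_0: "poly_expansion 0 = 0"
  by (simp add: poly_expansion_def)

lemma poly_expansion_pCons:
  "poly_expansion (pCons c p) = fls_const c + fls_X_inv * poly_expansion p"
  by (simp add: poly_expansion_def map_poly_pCons)

lemma poly_expansion_nth:
  includes fps_syntax
  shows "poly_expansion p $$ n = (if n \<le> 0 then coeff p (nat (- n)) else 0)"
proof (induction p arbitrary: n)
  case (pCons c p)
  thus ?case
    by (auto simp: poly_expansion_pCons fls_X_inv_times_conv_shift coeff_pCons nat_diff_distrib' 
             split: nat.splits)
qed (simp add: poly_expansion_0)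

lemma poly_expansion_eq_0_iff: "poly_expansion p = 0 \<longleftrightarrow> p = 0"
proof
  assume *: "poly_expansion p = 0"
  have "coeff p n = 0" for n
    using poly_expansion_nth[of p "- int n"] by (simp add: *)
  thus "p = 0"
    by (simp add: poly_eq_iff)
qed (simp add: poly_expansion_0)

lemma poly_expansion_add: "poly_expansion (p + q) = poly_expansion p + poly_expansion q"
  by (rule fls_eqI) (simp add: poly_expansion_nth)

lemma poly_expansion_smult: "poly_expansion (smult c p) = fls_const c * poly_expansion p"
  by (rule fls_eqI) (simp add: poly_expansion_nth)

lemma poly_expansion_mult: "poly_expansion (p * q) = poly_expansion p * poly_expansion q"
  by (induction p)
     (simp_all add: poly_expansion_0 poly_expansion_pCons poly_expansion_add poly_expansion_smult
        algebra_simps)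

lemma ratfun_expansion_Fract:
  assumes "q \<noteq> 0"
  shows "ratfun_expansion (Fract p q) = poly_expansion p / poly_expansion q"
proof -
  define u v where "u = fst (quot_of_fract (Fract p q))" and "v = snd (quot_of_fract (Fract p q))"
  have v: "v \<noteq> 0"
    by (simp add: v_def)
  have "Fract u v = Fract p q"
    unfolding u_def v_def by (rule Fract_quot_of_fract)
  hence "u * q = p * v"
    using assms v by (simp add: eq_fract)
  hence "poly_expansion u * poly_expansion q = poly_expansion p * poly_expansion v"
    by (metis poly_expansion_mult)
  thus ?thesis
    using assms v
    by (simp add: ratfun_expansion_def u_def v_def poly_expansion_eq_0_iff frac_eq_eq)
qed

end

(*
  The proof is algebraic.  Let M be a torsion-free C[x]-module with a derivation D and an injective
  shift S commuting with D, and let f in M satisfy both equations.  The C[x]-span E of the elements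
  D^i S^j f is stable under D and S up to denominators, say q D E <= E, and is commensurable with
  S^k E.  Let L be the set of all v whose derivatives D^i v have a common denominator with respect
  to E; it is stable under x, D and S.  Choosing k with q(x) and q(x+k) coprime shows that L is
  itself commensurable with E, that is, all singularities are apparent.
  Counting dimensions, L has finite rank over C[D].  There S acts linearly, while [x, S] = -S and x
  acts as a derivation; comparing a relation of minimal degree in S with its commutator with x
  shows that a power of S annihilates L up to C[D]-torsion, so that L itself is C[D]-torsion.
  Hence h f satisfies an equation with constant coefficients for some polynomial h, which is
  solved directly in each of the two situations.
*)
theory Submission
  imports Defs "HOL-Library.Function_Algebras"
begin

section \<open>Polynomials in an endomorphism of a module\<close>

text \<open>The obstacle is the shift: repeated use of \<open>S\<close> can move denominators to
  ever new points, and infinitely many poles mean infinite rank over C[D] (the functions 1/(x + j)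
  are independent over C[D]). So the lattice L has to be S-stable and at the same time lie within
  one fixed denominator of E. Both hold because an element whose derivatives share some denominator
  has poles relative to E only at zeros of q(x), and relative to S^k E only at zeros of q(x+k). If
  these zero sets are disjoint, a Bezout identity leaves nothing but the factor h by which E and S^k
  E differ, and h does not depend on the element. A relation in S of minimal degree collapses to its
  leading term because a b' - a' b = e a b has no solution with nonzero a, b in C[D] and e > 0: the
  left side has smaller degree. In other words, b/a would have to be an exponential. Only algebraic
  rules, torsion-freeness and injectivity of S enter, so one argument serves both the Laurent series
  in 1/x and the meromorphic functions, the latter encoded by germs.\<close>

definition op_poly :: "('a::comm_ring_1 \<Rightarrow> 'm \<Rightarrow> 'm) \<Rightarrow> ('m \<Rightarrow> 'm) \<Rightarrow> 'a poly \<Rightarrow> 'm::ab_group_add \<Rightarrow> 'm"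
  where "op_poly s T P v = (\<Sum>i\<le>degree P. s (coeff P i) ((T ^^ i) v))"

locale module_endo = module scale for scale :: "'a::comm_ring_1 \<Rightarrow> 'm::ab_group_add \<Rightarrow> 'm" (infixr \<open>\<odot>\<close> 75) +
  fixes T :: "'m \<Rightarrow> 'm"
  assumes T_add: "T (x + y) = T x + T y"
      and T_scale: "T (c \<odot> x) = c \<odot> T x"
begin

sublocale T: Modules.additive T
  by standard (rule T_add)

lemma T_pow_add: "(T ^^ i) (x + y) = (T ^^ i) x + (T ^^ i) y"
  by (induction i) (auto simp: T_add)

lemma op_poly_altdef: "degree P \<le> n \<Longrightarrow> op_poly scale T P v = (\<Sum>i\<le>n. coeff P i \<odot> (T ^^ i) v)"
  unfolding op_poly_def by (rule sum.mono_neutral_left) (auto simp: coeff_eq_0)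

lemma op_poly_0: "op_poly scale T 0 v = 0"
  by (simp add: op_poly_def)

lemma op_poly_pCons: "op_poly scale T (pCons a P) v = a \<odot> v + T (op_poly scale T P v)"
proof -
  have "op_poly scale T (pCons a P) v = (\<Sum>i\<le>Suc (degree P). coeff (pCons a P) i \<odot> (T ^^ i) v)"
    by (rule op_poly_altdef) (simp add: degree_pCons_le)
  also have "\<dots> = a \<odot> v + T (op_poly scale T P v)"
    by (subst sum.atMost_Suc_shift) (simp add: op_poly_def T.sum T_scale)
  finally show ?thesis .
qed

lemma op_poly_add: "op_poly scale T (P + Q) v = op_poly scale T P v + op_poly scale T Q v"
proof -
  define n where "n = max (degree P) (degree Q)"
  have "degree P \<le> n" "degree Q \<le> n" "degree (P + Q) \<le> n"
    by (auto simp: n_def degree_add_le)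
  thus ?thesis
    by (simp add: op_poly_altdef scale_left_distrib sum.distrib)
qed

lemma op_poly_smult: "op_poly scale T (smult c P) v = c \<odot> op_poly scale T P v"
  by (induction P) (simp_all add: op_poly_0 op_poly_pCons scale_right_distrib T_scale)

lemma op_poly_mult: "op_poly scale T (P * Q) v = op_poly scale T P (op_poly scale T Q v)"
  by (induction P) (simp_all add: op_poly_0 op_poly_pCons op_poly_add op_poly_smult)

lemma op_poly_1: "op_poly scale T 1 v = v"
  by (simp add: one_pCons op_poly_pCons op_poly_0 T.zero)

lemma op_poly_right_distrib: "op_poly scale T P (x + y) = op_poly scale T P x + op_poly scale T P y"
  by (simp add: op_poly_def T_pow_add scale_right_distrib sum.distrib)

text \<open>This makes the construction iterable: applied to \<open>D\<close> over C it gives an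
  action of C[D], and applied to \<open>S\<close> over C[D] it gives one of C[D][S].\<close>

lemma module_op_poly: "module (op_poly scale T)"
  by unfold_locales (simp_all add: op_poly_right_distrib op_poly_add op_poly_mult op_poly_1)

lemma op_poly_commute:
  assumes "Modules.additive U" "\<And>c x. U (c \<odot> x) = c \<odot> U x" "\<And>x. U (T x) = T (U x)"
  shows "U (op_poly scale T P v) = op_poly scale T P (U v)"
proof -
  interpret U: Modules.additive U by fact
  show ?thesis
    by (induction P) (simp_all add: op_poly_0 op_poly_pCons U.zero U.add assms)
qed

lemma op_poly_monom: "op_poly scale T (monom c n) v = c \<odot> (T ^^ n) v"
  by (subst op_poly_altdef[of _ n]) (auto simp: degree_monom_le if_distrib[of "\<lambda>c. c \<odot> _"] cong: if_cong)

end

text \<open>Phrased for an indexed family, so that a repeated vector counts as a dependency: the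
  vectors met later are not known to be distinct.\<close>

lemma (in vector_space) dependent_family:
  assumes "finite I" "finite B" "v ` I \<subseteq> span B" "card B < card I"
  shows "\<exists>c. (\<exists>i\<in>I. c i \<noteq> 0) \<and> (\<Sum>i\<in>I. scale (c i) (v i)) = 0"
proof (cases "inj_on v I")
  case True
  hence "card (v ` I) = card I" by (rule card_image)
  hence "dependent (v ` I)"
    using independent_span_bound[of B "v ` I"] assms by fastforce
  then obtain u where u: "\<exists>x\<in>v ` I. u x \<noteq> 0" "(\<Sum>x\<in>v ` I. scale (u x) x) = 0"
    using dependent_finite[of "v ` I"] assms by auto
  have "(\<Sum>i\<in>I. scale (u (v i)) (v i)) = 0"
    using u(2) by (subst (asm) sum.reindex[OF True]) simp
  with u(1) show ?thesis by (intro exI[of _ "\<lambda>i. u (v i)"]) auto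
next
  case False
  then obtain i j where ij: "i \<in> I" "j \<in> I" "i \<noteq> j" "v i = v j"
    by (auto simp: inj_on_def)
  define c where "c = (\<lambda>k. if k = i then 1 else if k = j then -1 else 0 :: 'a)"
  have "(\<Sum>k\<in>I. scale (c k) (v k)) = (\<Sum>k\<in>{i,j}. scale (c k) (v k))"
    using ij assms by (intro sum.mono_neutral_right) (auto simp: c_def)
  also have "\<dots> = 0" using ij by (simp add: c_def)
  finally show ?thesis using ij by (intro exI[of _ c]) (auto simp: c_def)
qed

section \<open>Submodules up to denominators over an integral domain\<close>

locale domain_module = module scale
  for scale :: "'a::idom \<Rightarrow> 'b::ab_group_add \<Rightarrow> 'b" (infixr \<open>\<odot>\<close> 75)
begin

text \<open>Over C[x] this replaces the span over C(x) without leaving the module; over C[D], the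
  saturation of \<open>{0}\<close> is the torsion part.\<close>

definition saturation :: "'b set \<Rightarrow> 'b set" where
  "saturation E = {v. \<exists>g. g \<noteq> 0 \<and> g \<odot> v \<in> E}"

lemma saturationI: "g \<odot> v \<in> E \<Longrightarrow> g \<noteq> 0 \<Longrightarrow> v \<in> saturation E"
  by (auto simp: saturation_def)

lemma saturationE:
  assumes "v \<in> saturation E" obtains g where "g \<noteq> 0" "g \<odot> v \<in> E"
  using assms by (auto simp: saturation_def)

lemma saturation_superset: "E \<subseteq> saturation E"
  by (auto intro: saturationI[of 1])

lemma saturation_mono: "E \<subseteq> F \<Longrightarrow> saturation E \<subseteq> saturation F"
  by (auto simp: saturation_def)

lemma subspace_saturation:
  assumes "subspace E" shows "subspace (saturation E)"
proof (rule subspaceI)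
  show "0 \<in> saturation E"
    using subspace_0[OF assms] by (auto intro: saturationI[of 1])
next
  fix x y assume "x \<in> saturation E" "y \<in> saturation E"
  then obtain g h where gh: "g \<noteq> 0" "h \<noteq> 0" "g \<odot> x \<in> E" "h \<odot> y \<in> E"
    by (auto simp: saturation_def)
  have "h \<odot> g \<odot> x + g \<odot> h \<odot> y \<in> E"
    by (rule subspace_add[OF assms subspace_scale[OF assms gh(3)] subspace_scale[OF assms gh(4)]])
  hence "(g * h) \<odot> (x + y) \<in> E"
    by (simp add: scale_right_distrib mult.commute)
  thus "x + y \<in> saturation E" using gh by (auto intro: saturationI[of "g * h"])
next
  fix c x assume "x \<in> saturation E"
  then obtain g where g: "g \<noteq> 0" "g \<odot> x \<in> E" by (auto simp: saturation_def)
  have "c \<odot> g \<odot> x \<in> E" by (rule subspace_scale[OF assms g(2)])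
  thus "c \<odot> x \<in> saturation E" using g by (auto intro: saturationI[of g] simp: mult.commute)
qed

lemma saturation_scaleD: "g \<odot> v \<in> saturation E \<Longrightarrow> g \<noteq> 0 \<Longrightarrow> v \<in> saturation E"
proof -
  assume "g \<odot> v \<in> saturation E" "g \<noteq> 0"
  then obtain h where "h \<noteq> 0" "h \<odot> g \<odot> v \<in> E" by (auto elim: saturationE)
  thus ?thesis using \<open>g \<noteq> 0\<close> by (intro saturationI[of "h * g"]) auto
qed

lemma saturation_saturation: "saturation (saturation E) \<subseteq> saturation E"
  by (auto elim: saturationE saturation_scaleD)

lemma common_denominator:
  assumes E: "subspace E" and "finite G" "G \<subseteq> saturation E"
  shows "\<exists>q. q \<noteq> 0 \<and> (\<forall>v\<in>span G. q \<odot> v \<in> E)"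
proof -
  have "\<exists>q. q \<noteq> 0 \<and> (\<forall>v\<in>G. q \<odot> v \<in> E)"
    using assms(2,3)
  proof (induction G rule: finite_induct)
    case (insert x G)
    then obtain q where q: "q \<noteq> 0" "\<forall>v\<in>G. q \<odot> v \<in> E" by auto
    obtain g where g: "g \<noteq> 0" "g \<odot> x \<in> E" using insert.prems by (auto elim: saturationE)
    have "(g * q) \<odot> v \<in> E" if "v \<in> insert x G" for v
      using that
    proof
      assume "v = x"
      thus ?thesis using subspace_scale[OF E g(2), of q] by (simp add: mult.commute)
    next
      assume "v \<in> G"
      thus ?thesis using subspace_scale[OF E, of "q \<odot> v" g] q by simp
    qed
    thus ?case using q g by (intro exI[of _ "g * q"]) auto
  qed (auto intro: exI[of _ 1])
  then obtain q where q: "q \<noteq> 0" "\<forall>v\<in>G. q \<odot> v \<in> E" by blast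
  have "q \<odot> v \<in> E" if "v \<in> span G" for v
    using that
  proof (induction rule: span_induct_alt)
    case base
    show ?case using subspace_0[OF E] by simp
  next
    case (step c x y)
    have "c \<odot> q \<odot> x + q \<odot> y \<in> E" using step q subspace_scale[OF E, of "q \<odot> x" c] by (intro subspace_add[OF E]) auto
    thus ?case by (simp add: scale_right_distrib mult.commute)
  qed
  with q show ?thesis by blast
qed

end

section \<open>Modules with a derivation and a shift\<close>

text \<open>The scalars are the polynomials in \<open>x\<close>, \<open>D\<close> extends \<open>d/dx\<close> and \<open>S\<close> extends \<open>x \<mapsto> x + 1\<close>.\<close>

locale delta_sigma_module = domain_module scale
  for scale :: "complex poly \<Rightarrow> 'm::ab_group_add \<Rightarrow> 'm" (infixr \<open>\<odot>\<close> 75) +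
  fixes D S :: "'m \<Rightarrow> 'm"
  assumes torsion_free: "p \<odot> v = 0 \<Longrightarrow> p = 0 \<or> v = 0"
      and D_add: "D (v + w) = D v + D w"
      and D_scale: "D (p \<odot> v) = pderiv p \<odot> v + p \<odot> D v"
      and S_add: "S (v + w) = S v + S w"
      and S_scale: "S (p \<odot> v) = pcompose p [:1, 1:] \<odot> S v"
      and D_S: "D (S v) = S (D v)"
      and S_eq_0: "S v = 0 \<Longrightarrow> v = 0"
begin

sublocale D: Modules.additive D by standard (rule D_add)
sublocale S: Modules.additive S by standard (rule S_add)

lemma S_pow_scale: "(S ^^ k) (p \<odot> v) = pcompose p [:of_nat k, 1:] \<odot> (S ^^ k) v"
  by (induction k) (simp_all add: S_scale flip: pcompose_assoc add: pcompose_pCons add_ac)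

lemma S_pow_add: "(S ^^ k) (v + w) = (S ^^ k) v + (S ^^ k) w"
  by (induction k) (simp_all add: S_add)

lemma S_pow_D: "(S ^^ k) (D v) = D ((S ^^ k) v)"
  by (induction k) (simp_all add: D_S)

lemma S_pow_D_pow: "(S ^^ k) ((D ^^ i) v) = (D ^^ i) ((S ^^ k) v)"
  by (induction i) (simp_all add: S_pow_D)

lemma S_pow_0: "(S ^^ k) 0 = 0"
  by (induction k) (simp_all add: S.zero)

lemma D_pow_add: "(D ^^ k) (v + w) = (D ^^ k) v + (D ^^ k) w"
  by (induction k) (simp_all add: D_add)

lemma S_pow_eq_0: "(S ^^ k) v = 0 \<Longrightarrow> v = 0"
  by (induction k) (auto dest: S_eq_0)

lemma shift_neq_0: "p \<noteq> 0 \<Longrightarrow> pcompose p [:c, 1:] \<noteq> (0 :: complex poly)"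
  by (simp add: pcompose_eq_0_iff)

lemma D_saturation:
  assumes E: "subspace E" and D: "\<And>v. v \<in> E \<Longrightarrow> D v \<in> saturation E" and v: "v \<in> saturation E"
  shows "D v \<in> saturation E"
proof -
  obtain g where g: "g \<noteq> 0" "g \<odot> v \<in> E" using v by (rule saturationE)
  have "D (g \<odot> v) - pderiv g \<odot> v \<in> saturation E"
    by (intro subspace_diff subspace_saturation E D g subspace_scale v)
  hence "g \<odot> D v \<in> saturation E" by (simp add: D_scale)
  thus ?thesis using g(1) by (rule saturation_scaleD)
qed

lemma S_saturation:
  assumes S: "\<And>v. v \<in> E \<Longrightarrow> S v \<in> saturation F" and v: "v \<in> saturation E"
  shows "S v \<in> saturation F"
proof -
  obtain g where g: "g \<noteq> 0" "g \<odot> v \<in> E" using v by (rule saturationE)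
  have "pcompose g [:1, 1:] \<odot> S v \<in> saturation F" using S[OF g(2)] by (simp add: S_scale)
  thus ?thesis using shift_neq_0[OF g(1)] by (rule saturation_scaleD)
qed

lemma common_denominator_D:
  assumes "finite G" "D ` G \<subseteq> saturation (span G)"
  shows "\<exists>q. q \<noteq> 0 \<and> (\<forall>v\<in>span G. q \<odot> D v \<in> span G)"
proof -
  obtain q where q: "q \<noteq> 0" "\<forall>v\<in>span (D ` G). q \<odot> v \<in> span G"
    using common_denominator[OF subspace_span, of "D ` G" G] assms by auto
  have "q \<odot> D v \<in> span G" if "v \<in> span G" for v
    using that
  proof (induction rule: span_induct_alt)
    case base
    show ?case by (simp add: D.zero span_zero)
  next
    case (step c x y)
    have "(q * pderiv c) \<odot> x + (c \<odot> q \<odot> D x + q \<odot> D y) \<in> span G"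
      using step q by (intro span_add span_scale[of x] span_scale[of "q \<odot> D x"]) (auto intro: span_base)
    thus ?case by (simp add: scale_right_distrib D_scale D_add mult.commute add_ac)
  qed
  with q show ?thesis by blast
qed

text \<open>\<open>S\<close> is only semilinear, but c(x) -> c(x + k) is invertible on C[x], so a
  scalar can be pulled back through \<open>S ^^ k\<close>.\<close>

lemma subspace_S_pow: assumes "subspace E" shows "subspace ((S ^^ k) ` E)"
proof (rule subspaceI)
  show "0 \<in> (S ^^ k) ` E" using subspace_0[OF assms] S_pow_0[of k] by (metis imageI)
next
  fix x y assume "x \<in> (S ^^ k) ` E" "y \<in> (S ^^ k) ` E"
  thus "x + y \<in> (S ^^ k) ` E" using subspace_add[OF assms] 
    by (auto simp flip: S_pow_add)
next
  fix c :: "complex poly" and x assume "x \<in> (S ^^ k) ` E"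
  then obtain e where e: "e \<in> E" "x = (S ^^ k) e" by auto
  have "pcompose (pcompose c [:- of_nat k, 1:]) [:of_nat k, 1:] = c"
  proof -
    have "pcompose [:- of_nat k, 1:] [:of_nat k, 1:] = [:0, 1 :: complex:]"
      by (simp add: pcompose_pCons)
    thus ?thesis by (simp only: pcompose_assoc[symmetric] pcompose_idR)
  qed
  hence "c \<odot> x = (S ^^ k) (pcompose c [:- of_nat k, 1:] \<odot> e)"
    by (simp add: S_pow_scale e)
  thus "c \<odot> x \<in> (S ^^ k) ` E" using subspace_scale[OF assms e(1)] by simp
qed

lemma S_pow_span: "(S ^^ k) ` span G \<subseteq> span ((S ^^ k) ` G)"
proof safe
  fix v assume "v \<in> span G"
  thus "(S ^^ k) v \<in> span ((S ^^ k) ` G)"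
    by (induction rule: span_induct_alt)
      (auto simp: S_pow_0 S_pow_add S_pow_scale span_zero intro!: span_add span_scale intro: span_base)
qed

section \<open>Denominators of derivatives and the stable lattice\<close>

lemma times_pderiv_power: "p * pderiv (p ^ n) = of_nat n * pderiv p * p ^ n"
  by (induction n) (simp_all add: pderiv_mult pderiv_1 algebra_simps)

text \<open>The polynomials that clear all derivatives of \<open>v\<close> form an ideal, and the
  product rule shows that it is closed under g -> q g'. This confines the roots of its generator to
  those of \<open>q\<close>, whatever the roots of the given \<open>g\<close> are.\<close>

lemma pole_bound:
  assumes E: "subspace E" and q: "\<And>v. v \<in> E \<Longrightarrow> q \<odot> D v \<in> E"
      and g: "g \<noteq> 0" "\<And>i. g \<odot> (D ^^ i) v \<in> E"
  shows "\<exists>b. q ^ b \<odot> v \<in> E"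
proof -
  define I where "I = (\<lambda>g. \<forall>i. g \<odot> (D ^^ i) v \<in> E)"
  have I_scale: "I (c * g)" if "I g" for c g
    using that subspace_scale[OF E, of "g \<odot> _" c] by (simp add: I_def)
  have I_diff: "I (a - b)" if "I a" "I b" for a b
    using that subspace_diff[OF E] by (simp add: I_def scale_left_diff_distrib)
  define g0 where "g0 = arg_min degree (\<lambda>g. g \<noteq> 0 \<and> I g)"
  have "g0 \<noteq> 0 \<and> I g0"
    unfolding g0_def by (rule arg_min_natI[of _ g]) (use g in \<open>auto simp: I_def\<close>)
  hence g0: "g0 \<noteq> 0" "I g0" by auto
  have min: "degree g0 \<le> degree p" if "p \<noteq> 0" "I p" for p
    unfolding g0_def by (rule arg_min_nat_le) (use that in auto)
  have "I (q * pderiv g0)"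
    unfolding I_def
  proof
    fix i
    have "q \<odot> D (g0 \<odot> (D ^^ i) v) - q \<odot> (g0 \<odot> (D ^^ Suc i) v) \<in> E"
      using g0(2) by (intro subspace_diff[OF E] q subspace_scale[OF E, of "g0 \<odot> (D ^^ Suc i) v"]) (simp_all only: I_def)
    thus "(q * pderiv g0) \<odot> (D ^^ i) v \<in> E"
      by (simp add: D_scale scale_right_distrib)
  qed
  \<comment> \<open>By minimality, \<open>g0\<close> divides \<open>q * pderiv g0\<close>, so all its roots are roots of \<open>q\<close>.\<close>
  hence "I (q * pderiv g0 - (q * pderiv g0 div g0) * g0)"
    by (intro I_diff I_scale[OF g0(2)])
  hence "I (q * pderiv g0 mod g0)" by (simp add: minus_div_mult_eq_mod)
  moreover have "q * pderiv g0 mod g0 = 0 \<or> degree (q * pderiv g0 mod g0) < degree g0"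
    using degree_mod_less[OF g0(1)] by simp
  ultimately have "q * pderiv g0 mod g0 = 0"
    using min[of "q * pderiv g0 mod g0"] by linarith
  hence dvd: "g0 dvd q * pderiv g0" by (simp add: dvd_eq_mod_eq_0)
  have "poly q a = 0" if a: "poly g0 a = 0" for a
  proof (rule ccontr)
    assume qa: "poly q a \<noteq> 0"
    have "degree g0 \<noteq> 0" using a g0(1) by (intro notI) (auto elim!: degree_eq_zeroE)
    hence pd: "pderiv g0 \<noteq> 0" by (simp add: pderiv_eq_0_iff)
    have q0: "q \<noteq> 0" using qa by auto
    \<comment> \<open>Off the roots of \<open>q\<close>, divisibility would give
      \<open>pderiv g0\<close> at least the multiplicity of \<open>g0\<close> at \<open>a\<close>,
      but differentiation lowers it by one.\<close>
    have "order a g0 \<le> order a (q * pderiv g0)"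
      using dvd pd q0 by (intro dvd_imp_order_le) auto
    also have "\<dots> = order a (pderiv g0)"
      using qa pd q0 by (simp add: order_mult order_0I)
    finally have "order a g0 \<le> order a (pderiv g0)" .
    moreover have "order a g0 = Suc (order a (pderiv g0))"
      by (rule order_pderiv[OF g0(1) a])
    ultimately show False by simp
  qed
  hence "g0 dvd q ^ degree g0"
    using nullstellensatz_univariate[of g0 q] g0(1) by blast
  then obtain c where "q ^ degree g0 = g0 * c" by (elim dvdE)
  hence "q ^ degree g0 = c * g0" by (simp add: mult.commute)
  with I_scale[OF g0(2), of c] have "I (q ^ degree g0)" by simp
  hence "q ^ degree g0 \<odot> (D ^^ 0) v \<in> E" unfolding I_def by (rule spec)
  thus ?thesis by auto
qed

text \<open>Any \<open>k\<close> that is not a difference of two roots of \<open>q\<close> will do,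
  and there are only finitely many such differences.\<close>

lemma coprime_shift:
  fixes q :: "complex poly"
  assumes "q \<noteq> 0"
  shows "\<exists>k::nat. coprime q (pcompose q [:of_nat k, 1:])"
proof -
  define R where "R = {a. poly q a = 0}"
  have fin: "finite R" unfolding R_def by (rule poly_roots_finite) fact
  have "finite ((\<lambda>k. of_nat k :: complex) -` ((\<lambda>(a,b). a - b) ` (R \<times> R)))"
    by (rule finite_vimageI) (use fin in \<open>auto simp: inj_on_def\<close>)
  then obtain k :: nat where k: "(of_nat k :: complex) \<notin> (\<lambda>(a,b). a - b) ` (R \<times> R)"
    by (metis ex_new_if_finite infinite_UNIV_nat vimageI)
  have "coprime q (pcompose q [:of_nat k, 1:])"
  proof (rule ccontr)
    assume nc: "\<not> coprime q (pcompose q [:of_nat k, 1:])"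
    define d where "d = gcd q (pcompose q [:of_nat k, 1:])"
    have "\<not> is_unit d" using nc by (simp add: d_def coprime_iff_gcd_eq_1 is_unit_gcd)
    moreover have d0: "d \<noteq> 0" using assms by (simp add: d_def)
    ultimately have "degree d \<noteq> 0" by (simp add: is_unit_iff_degree)
    then obtain a where a: "poly d a = 0"
      using fundamental_theorem_of_algebra[of d] by (auto simp: constant_degree)
    have "poly q a = 0" "poly (pcompose q [:of_nat k, 1:]) a = 0"
      using a by (auto simp: d_def dest: poly_eq_0_iff_dvd[THEN iffD1]
         intro!: poly_eq_0_iff_dvd[THEN iffD2] elim: dvd_trans)
    hence "a \<in> R" "of_nat k + a \<in> R" by (auto simp: R_def poly_pcompose)
    hence "(of_nat k + a, a) \<in> R \<times> R" by auto
    hence "of_nat k + a - a \<in> (\<lambda>(a,b). a - b) ` (R \<times> R)"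
      by (metis (mono_tags, lifting) case_prod_conv imageI)
    with k show False by simp
  qed
  thus ?thesis ..
qed

text \<open>\<open>S'\<close> complements \<open>S\<close>: together they make \<open>span G\<close>
  commensurable with each of its images under \<open>S ^^ k\<close>, so that denominators can be
  measured against either module.\<close>

lemma ex_stable_lattice:
  assumes G: "finite G" and D: "D ` G \<subseteq> saturation (span G)"
      and S: "S ` G \<subseteq> saturation (span G)" and S': "G \<subseteq> saturation (S ` span G)"
  shows "\<exists>L h. h \<noteq> 0 \<and> subspace L \<and> D ` L \<subseteq> L \<and> S ` L \<subseteq> L \<and>
           (\<forall>v\<in>L. h \<odot> v \<in> span G) \<and> (\<forall>v\<in>span G. h \<odot> v \<in> L)"
proof -
  define E where "E = span G"
  have E: "subspace E" by (simp add: E_def)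
  obtain q where q: "q \<noteq> 0" "\<And>v. v \<in> E \<Longrightarrow> q \<odot> D v \<in> E"
    using that common_denominator_D[OF G D, folded E_def] by (elim exE conjE) blast
  obtain k where k: "coprime q (pcompose q [:of_nat k, 1:])"
    using coprime_shift[OF q(1)] by blast
  define r where "r = pcompose q [:of_nat k, 1:]"
  define F where "F = (S ^^ k) ` E"
  have F: "subspace F" unfolding F_def by (rule subspace_S_pow) fact
  obtain s where s: "s \<noteq> 0" "\<And>v. v \<in> E \<Longrightarrow> s \<odot> S v \<in> E"
  proof -
    obtain s where s: "s \<noteq> 0" "\<forall>v\<in>span (S ` G). s \<odot> v \<in> E"
      using common_denominator[OF E finite_imageI[OF G] S[folded E_def]] by (elim exE conjE)
    have *: "S v \<in> span (S ` G)" if "v \<in> E" for v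
      using S_pow_span[of 1 G] imageI[OF that[unfolded E_def], of S] by (simp add: subset_iff)
    show ?thesis using * s by (intro that[of s]) auto
  qed
  have S_sat: "S v \<in> saturation E" if "v \<in> E" for v
    by (rule saturationI[OF s(2)[OF that] s(1)])
  have S_pow_sat: "(S ^^ j) v \<in> saturation E" if "v \<in> saturation E" for v j
    by (induction j) (use that in \<open>simp_all add: S_saturation[OF S_sat]\<close>)
  have E_sub: "E \<subseteq> saturation ((S ^^ j) ` E)" for j
  proof (induction j)
    case 0
    show ?case by (simp add: saturation_superset)
  next
    case (Suc j)
    have "S v \<in> saturation ((S ^^ Suc j) ` E)" if "v \<in> E" for v
    proof (rule S_saturation)
      show "v \<in> saturation ((S ^^ j) ` E)" using that Suc by blast
      show "S w \<in> saturation ((S ^^ Suc j) ` E)" if "w \<in> (S ^^ j) ` E" for w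
      proof -
        have "S w \<in> (S ^^ Suc j) ` E" using that by auto
        thus ?thesis using saturation_superset by blast
      qed
    qed
    hence "S ` E \<subseteq> saturation ((S ^^ Suc j) ` E)" by auto
    from saturation_mono[OF this] have "saturation (S ` E) \<subseteq> saturation ((S ^^ Suc j) ` E)"
      using saturation_saturation by (rule order.trans)
    with S' have "G \<subseteq> saturation ((S ^^ Suc j) ` E)" unfolding E_def by (rule order.trans)
    thus ?case unfolding E_def 
      by (rule span_minimal) (intro subspace_saturation subspace_S_pow subspace_span)
  qed
  obtain h1 where h1: "h1 \<noteq> 0" "\<And>v. v \<in> F \<Longrightarrow> h1 \<odot> v \<in> E"
  proof -
    have "(S ^^ k) ` G \<subseteq> saturation E"
    proof safe
      fix g assume "g \<in> G"
      hence "g \<in> saturation E" using saturation_superset[of E] by (auto simp: E_def intro: span_base)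
      thus "(S ^^ k) g \<in> saturation E" by (rule S_pow_sat)
    qed
    from common_denominator[OF E finite_imageI[OF G] this]
    obtain h where h: "h \<noteq> 0" "\<forall>v\<in>span ((S ^^ k) ` G). h \<odot> v \<in> E"
      by (elim exE conjE)
    have *: "v \<in> span ((S ^^ k) ` G)" if "v \<in> F" for v
      using S_pow_span[of k G] that unfolding E_def F_def by (rule subsetD)
    show ?thesis using * h by (intro that[of h]) auto
  qed
  obtain h2 where h2: "h2 \<noteq> 0" "\<And>v. v \<in> E \<Longrightarrow> h2 \<odot> v \<in> F"
  proof -
    have "G \<subseteq> saturation F"
      using span_superset[of G] E_sub[of k] unfolding E_def F_def by (rule order.trans)
    from common_denominator[OF F G this] show ?thesis using that by (fold E_def, elim exE conjE) blast
  qed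
  define h where "h = h1 * h2"
  have h0: "h \<noteq> 0" using h1 h2 by (simp add: h_def)
  have hF: "h \<odot> v \<in> E" if "v \<in> F" for v
    using subspace_scale[OF E h1(2)[OF that], of h2] by (simp add: h_def mult.commute)
  have hE: "h \<odot> v \<in> F" if "v \<in> E" for v
    using subspace_scale[OF F h2(2)[OF that], of h1] by (simp add: h_def)
  have r: "r \<odot> D v \<in> F" if v: "v \<in> F" for v
  proof -
    obtain e where e: "e \<in> E" "v = (S ^^ k) e" using v by (auto simp: F_def)
    have "r \<odot> D v = (S ^^ k) (q \<odot> D e)" by (simp add: S_pow_scale r_def e S_pow_D)
    thus ?thesis using q(2)[OF e(1)] by (simp add: F_def)
  qed
  \<comment> \<open>The denominator divides both \<open>q ^ a\<close> and \<open>h * r ^ b\<close>, hence \<open>h\<close>.\<close>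
  have key: "h \<odot> v \<in> E" if "q ^ a \<odot> v \<in> E" "r ^ b \<odot> v \<in> F" for v a b
  proof -
    have "coprime (q ^ a) (r ^ b)" using k by (simp add: r_def)
    hence "fst (bezout_coefficients (q ^ a) (r ^ b)) * q ^ a + snd (bezout_coefficients (q ^ a) (r ^ b)) * r ^ b = 1"
      by (simp only: bezout_coefficients_fst_snd coprime_iff_gcd_eq_1)
    then obtain u w where uw: "u * q ^ a + w * r ^ b = 1" by blast
    have "(h * u) \<odot> (q ^ a \<odot> v) + w \<odot> (h \<odot> (r ^ b \<odot> v)) \<in> E"
      by (intro subspace_add[OF E] subspace_scale[OF E that(1)] subspace_scale[OF E hF] that)
    also have "(h * u) \<odot> (q ^ a \<odot> v) + w \<odot> (h \<odot> (r ^ b \<odot> v)) = (h * (u * q ^ a + w * r ^ b)) \<odot> v"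
      by (simp add: scale_left_distrib distrib_left mult_ac)
    finally show ?thesis by (simp add: uw)
  qed
  define L where "L = {v. \<exists>g. g \<noteq> 0 \<and> (\<forall>i. g \<odot> (D ^^ i) v \<in> E)}"
  \<comment> \<open>\<open>pole_bound\<close> is used in \<open>E\<close> with \<open>q\<close> and
    in \<open>F\<close> with \<open>r\<close>. The exponents depend on \<open>v\<close>, but
    \<open>key\<close> makes them disappear.\<close>
  have hL: "h \<odot> v \<in> E" if "v \<in> L" for v
  proof -
    from that obtain g where g: "g \<noteq> 0" "\<And>i. g \<odot> (D ^^ i) v \<in> E" by (auto simp: L_def)
    have "h * g \<noteq> 0" using g(1) h0 by simp
    moreover have "(h * g) \<odot> (D ^^ i) v \<in> F" for i using hE[OF g(2)[of i]] by simp
    ultimately obtain b where "r ^ b \<odot> v \<in> F"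
      using pole_bound[OF F r] by blast
    moreover obtain a where "q ^ a \<odot> v \<in> E"
      using pole_bound[OF E q(2) g] by blast
    ultimately show ?thesis by (rule key[rotated])
  qed
  have Dq: "\<exists>a. q ^ a \<odot> (D ^^ i) v \<in> X" if X: "subspace X" "\<And>v. v \<in> X \<Longrightarrow> q \<odot> D v \<in> X" "v \<in> X"
    for X q v i
  proof (induction i)
    case 0
    show ?case using that by (intro exI[of _ 0]) simp
  next
    case (Suc i)
    then obtain a where a: "q ^ a \<odot> (D ^^ i) v \<in> X" by blast
    have "q \<odot> D (q ^ a \<odot> (D ^^ i) v) - (of_nat a * pderiv q) \<odot> q ^ a \<odot> (D ^^ i) v \<in> X"
      by (intro subspace_diff[OF X(1)] X(2) subspace_scale[OF X(1)] a)
    also have "q \<odot> D (q ^ a \<odot> (D ^^ i) v) - (of_nat a * pderiv q) \<odot> q ^ a \<odot> (D ^^ i) v =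
        q ^ Suc a \<odot> (D ^^ Suc i) v"
      by (simp add: D_scale scale_right_distrib times_pderiv_power)
    finally show ?case by blast
  qed
  \<comment> \<open>The inner factor \<open>h\<close> moves \<open>v\<close> into \<open>F\<close>
    while keeping it in \<open>E\<close>; each derivative is then cleared by a power of
    \<open>q\<close> and by a power of \<open>r\<close>, and the outer \<open>h\<close> from
    \<open>key\<close> is the same for all orders.\<close>
  have EL: "h \<odot> v \<in> L" if v: "v \<in> E" for v
  proof -
    have "h \<odot> (D ^^ i) (h \<odot> v) \<in> E" for i
    proof -
      obtain a where "q ^ a \<odot> (D ^^ i) (h \<odot> v) \<in> E"
        using Dq[OF E q(2), of "h \<odot> v"] subspace_scale[OF E v] by blast
      moreover obtain b where "r ^ b \<odot> (D ^^ i) (h \<odot> v) \<in> F"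
        using Dq[OF F r hE[OF v]] by blast
      ultimately show ?thesis by (rule key)
    qed
    thus ?thesis using h0 by (auto simp: L_def)
  qed
  have "subspace L"
  proof (rule subspaceI)
    have "(D ^^ i) 0 = 0" for i by (induction i) (simp_all add: D.zero)
    thus "0 \<in> L" using subspace_0[OF E] by (auto simp: L_def intro!: exI[of _ 1])
  next
    fix x y assume "x \<in> L" "y \<in> L"
    then obtain a b where ab: "a \<noteq> 0" "b \<noteq> 0" "\<And>i. a \<odot> (D ^^ i) x \<in> E" "\<And>i. b \<odot> (D ^^ i) y \<in> E"
      by (auto simp: L_def)
    have "(a * b) \<odot> (D ^^ i) (x + y) \<in> E" for i
    proof -
      have "b \<odot> a \<odot> (D ^^ i) x + a \<odot> b \<odot> (D ^^ i) y \<in> E"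
        by (intro subspace_add[OF E] subspace_scale[OF E ab(3)] subspace_scale[OF E ab(4)])
      thus ?thesis by (simp add: D_pow_add scale_right_distrib mult.commute)
    qed
    thus "x + y \<in> L" using ab by (auto simp: L_def intro!: exI[of _ "a * b"])
  next
    fix c x assume "x \<in> L"
    then obtain g where g: "g \<noteq> 0" "\<And>i. g \<odot> (D ^^ i) x \<in> E" by (auto simp: L_def)
    have "g \<odot> (D ^^ i) (c \<odot> y) \<in> E" if "\<And>i. g \<odot> (D ^^ i) y \<in> E" for i c y
      using that
    proof (induction i arbitrary: c y)
      case 0
      from subspace_scale[OF E 0[of 0], of c] show ?case by (simp add: mult.commute)
    next
      case (Suc i)
      have "g \<odot> (D ^^ j) (D y) \<in> E" for j using Suc.prems[of "Suc j"] by (simp add: funpow_swap1)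
      hence "g \<odot> (D ^^ i) (pderiv c \<odot> y) + g \<odot> (D ^^ i) (c \<odot> D y) \<in> E"
        by (intro subspace_add[OF E] Suc.IH) (use Suc.prems in auto)
      thus ?case by (simp add: funpow_swap1 D_scale D_pow_add scale_right_distrib)
    qed
    thus "c \<odot> x \<in> L" using g by (auto simp: L_def)
  qed
  moreover have "D ` L \<subseteq> L"
  proof safe
    fix v assume "v \<in> L"
    then obtain g where g: "g \<noteq> 0" "\<And>i. g \<odot> (D ^^ i) v \<in> E" by (auto simp: L_def)
    have "g \<odot> (D ^^ i) (D v) \<in> E" for i using g(2)[of "Suc i"] by (simp add: funpow_swap1)
    thus "D v \<in> L" using g by (auto simp: L_def)
  qed
  moreover have "S ` L \<subseteq> L"
  proof safe
    fix v assume "v \<in> L"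
    then obtain g where g: "g \<noteq> 0" "\<And>i. g \<odot> (D ^^ i) v \<in> E" by (auto simp: L_def)
    \<comment> \<open>As \<open>S\<close> commutes with \<open>D\<close>, the shift of
      \<open>g\<close> clears all derivatives of \<open>S v\<close> into the image of
      \<open>E\<close>, and \<open>s\<close> leads from there back to \<open>E\<close>.\<close>
    have "(s * pcompose g [:1, 1:]) \<odot> (D ^^ i) (S v) \<in> E" for i
      using s(2)[OF g(2)[of i]] S_pow_D_pow[of 1 i v] by (simp add: S_scale)
    thus "S v \<in> L" using g(1) s(1) shift_neq_0[of g 1]
      by (auto simp: L_def intro!: exI[of _ "s * pcompose g [:1, 1:]"])
  qed
  ultimately show ?thesis using h0 hL EL unfolding E_def by blast
qed

section \<open>The actions of C[D] and C[D][S]\<close>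

sublocale const: vector_space "\<lambda>c v. [:c:] \<odot> v"
  by unfold_locales
     (simp_all add: scale_right_distrib mult.commute flip: scale_left_distrib one_pCons)

sublocale const: module_endo "\<lambda>c v. [:c:] \<odot> v" D
  by unfold_locales (simp_all add: D_add D_scale)

abbreviation Dop :: "complex poly \<Rightarrow> 'm \<Rightarrow> 'm" where
  "Dop \<equiv> op_poly (\<lambda>c v. [:c:] \<odot> v) D"

sublocale Dop: domain_module Dop
  unfolding domain_module_def by (rule const.module_op_poly)

sublocale Dop: module_endo Dop S
proof unfold_locales
  show "S (Dop c x) = Dop c (S x)" for c x
    by (rule const.op_poly_commute) (simp_all add: S.additive_axioms S_scale D_S)
qed (rule S_add)

abbreviation DSop :: "complex poly poly \<Rightarrow> 'm \<Rightarrow> 'm" where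
  "DSop \<equiv> op_poly Dop S"

sublocale DSop: module DSop
  by (rule Dop.module_op_poly)

lemma x_Dop: "[:0, 1:] \<odot> Dop P v = Dop P ([:0, 1:] \<odot> v) - Dop (pderiv P) v"
proof (induction P)
  case (pCons a P)
  have *: "D ([:0, 1:] \<odot> w) = w + [:0, 1:] \<odot> D w" for w
    by (simp add: D_scale pderiv_pCons)
  have "[:0, 1:] \<odot> D (Dop P v) = D (Dop P ([:0, 1:] \<odot> v) - Dop (pderiv P) v) - Dop P v"
    using *[of "Dop P v"] pCons by simp
  thus ?case
    by (simp add: const.op_poly_pCons const.op_poly_add pderiv_pCons scale_right_distrib
          D.diff mult.commute del: pCons_0_0)
qed (simp_all add: const.op_poly_0)

text \<open>Since [D, x] = 1 and S x = (x + 1) S, bracketing with x acts on C[D][S] as the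
  derivation d/dD + S d/dS; the summand \<open>pCons 0 (pderiv R)\<close> is S d/dS.\<close>

lemma x_DSop:
  "[:0, 1:] \<odot> DSop R v =
     DSop R ([:0, 1:] \<odot> v) - DSop (map_poly pderiv R + pCons 0 (pderiv R)) v"
proof (induction R)
  case (pCons P R)
  have *: "[:0, 1:] \<odot> S w = S ([:0, 1:] \<odot> w) - S w" for w
  proof -
    have "[:1, 1:] = [:0, 1:] + (1 :: complex poly)" by (simp add: one_pCons)
    thus ?thesis by (simp add: S_scale pcompose_pCons scale_left_distrib)
  qed
  have "map_poly pderiv (pCons P R) = pCons (pderiv P) (map_poly pderiv R)"
    by (rule map_poly_pCons) simp
  thus ?case
    by (simp add: Dop.op_poly_pCons Dop.op_poly_add pderiv_pCons scale_right_distrib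
          S.diff S.add * pCons x_Dop del: pCons_0_0 add_pCons)
qed (simp_all add: Dop.op_poly_0)

lemma DSop_const: "DSop [:P:] v = Dop P v"
  by (simp add: Dop.op_poly_pCons Dop.op_poly_0 S.zero)

lemma Dop_DSop_commute: "Dop P (DSop R v) = DSop R (Dop P v)"
  by (metis DSop.scale_left_commute DSop_const)

text \<open>\<open>P\<close> sends x v to P'(D) v, which a second \<open>P\<close> kills. Hence the
  commutator with x of an operator that maps into torsion again maps into torsion.\<close>

lemma x_torsion:
  assumes "v \<in> Dop.saturation {0}"
  shows "[:0, 1:] \<odot> v \<in> Dop.saturation {0}"
proof -
  obtain P where P: "P \<noteq> 0" "Dop P v = 0" using assms by (auto elim: Dop.saturationE)
  have "Dop (P * P) ([:0, 1:] \<odot> v) = Dop P (Dop (pderiv P) v)"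
    using x_Dop[of P v] P by (simp flip: Dop.scale_scale)
  also have "\<dots> = Dop (pderiv P) (Dop P v)"
    by (rule Dop.scale_left_commute)
  finally show ?thesis using P by (intro Dop.saturationI[of "P * P"]) auto
qed

lemma torsion_of_rank_bound:
  fixes K :: nat
  assumes L: "subspace L" "D ` L \<subseteq> L" "S ` L \<subseteq> L"
      and K: "\<And>v. (\<And>i. i < K \<Longrightarrow> v i \<in> L) \<Longrightarrow>
                  \<exists>P. (\<exists>i<K. P i \<noteq> 0) \<and> (\<Sum>i<K. Dop (P i) (v i)) = 0"
  shows "L \<subseteq> Dop.saturation {0}"
proof -
  let ?T = "Dop.saturation {0}"
  have T: "Dop.subspace ?T" by (intro Dop.subspace_saturation Dop.subspace_single_0)
  \<comment> \<open>Independence over C[D] inside \<open>L\<close>. The rank bound caps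
    \<open>r\<close>, so there is a maximal family, and every element of \<open>L\<close> depends on
    it.\<close>
  define Ind where "Ind = (\<lambda>(r::nat) v. (\<forall>i<r. v i \<in> L) \<and> 
    (\<forall>P. (\<Sum>i<r. Dop (P i) (v i)) = 0 \<longrightarrow> (\<forall>i<r. P i = 0)))"
  have "\<exists>r v. Ind r v \<and> \<not>(\<exists>v. Ind (Suc r) v)"
  proof (rule ccontr)
    assume *: "\<not>?thesis"
    have "\<exists>v. Ind r v" for r
    proof (induction r)
      case 0
      show ?case by (simp add: Ind_def)
    next
      case (Suc r)
      with * show ?case by blast
    qed
    then obtain v where "Ind K v" by blast
    thus False using K[of v] by (auto simp: Ind_def)
  qed
  then obtain r v where v: "Ind r v" and max: "\<And>v. \<not>Ind (Suc r) v" by blast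
  have rel: "\<exists>P Q. Q \<noteq> 0 \<and> Dop Q w = - (\<Sum>i<r. Dop (P i) (v i))" if w: "w \<in> L" for w
  proof -
    define v' where "v' = v(r := w)"
    have v'_L: "\<forall>i<Suc r. v' i \<in> L" using v w by (auto simp: v'_def Ind_def)
    then obtain P i where P: "(\<Sum>i<Suc r. Dop (P i) (v' i)) = 0" "i < Suc r" "P i \<noteq> 0"
      using max[of v'] unfolding Ind_def by blast
    have sum0: "(\<Sum>i<r. Dop (P i) (v i)) + Dop (P r) w = 0"
      using P(1) by (simp add: v'_def)
    have "P r \<noteq> 0"
    proof
      assume Pr: "P r = 0"
      hence "\<forall>i<r. P i = 0" using sum0 v by (simp add: Ind_def)
      with P Pr show False by (auto simp: less_Suc_eq)
    qed
    moreover have "Dop (P r) w = - (\<Sum>i<r. Dop (P i) (v i))"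
      using sum0 by (metis add.commute eq_neg_iff_add_eq_0)
    ultimately show ?thesis by blast
  qed
  have S_pow_L: "(S ^^ j) w \<in> L" if "w \<in> L" for w j
    using that L(3) by (induction j) auto
  \<comment> \<open>A C[D]-dependency among the first \<open>K\<close> iterates of \<open>S\<close>
    on \<open>v i\<close> is a polynomial relation in \<open>S\<close>.\<close>
  have "\<exists>R. R \<noteq> 0 \<and> DSop R (v i) = 0" if i: "i < r" for i
  proof -
    have "v i \<in> L" using v i by (auto simp: Ind_def)
    then obtain P j where P: "j < K" "P j \<noteq> 0" "(\<Sum>j<K. Dop (P j) ((S ^^ j) (v i))) = 0"
      using K[of "\<lambda>j. (S ^^ j) (v i)"] S_pow_L by blast
    define R where "R = (\<Sum>j<K. monom (P j) j)"
    have "coeff R j = P j" unfolding R_def using P(1) 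
      by (subst coeff_sum) (simp add: if_distrib cong: if_cong)
    hence "R \<noteq> 0" using P(2) by auto
    moreover have "DSop R (v i) = 0"
      unfolding R_def by (simp add: DSop.scale_sum_left Dop.op_poly_monom P(3))
    ultimately show ?thesis by blast
  qed
  then obtain Ri where Ri: "\<And>i. i < r \<Longrightarrow> Ri i \<noteq> 0" "\<And>i. i < r \<Longrightarrow> DSop (Ri i) (v i) = 0"
    by metis
  \<comment> \<open>Since operators in \<open>D\<close> and \<open>S\<close> commute, the product of
    the \<open>Ri\<close> kills the whole maximal family, and therefore sends every element of
    \<open>L\<close> to torsion.\<close>
  define good where "good = (\<lambda>R. \<forall>w\<in>L. DSop R w \<in> ?T)"
  have "good (\<Prod>i<r. Ri i)"
    unfolding good_def
  proof
    fix w assume "w \<in> L"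
    then obtain P Q where PQ: "Q \<noteq> 0" "Dop Q w = - (\<Sum>i<r. Dop (P i) (v i))" using rel by blast
    define R where "R = (\<Prod>i<r. Ri i)"
    have R0: "DSop R (v i) = 0" if "i < r" for i
    proof -
      have "Ri i dvd R" unfolding R_def by (rule dvd_prodI) (use that in auto)
      then obtain c where "R = c * Ri i" by (metis dvd_def mult.commute)
      thus ?thesis using Ri(2)[OF that] by (simp flip: DSop.scale_scale)
    qed
    have "Dop Q (DSop R w) = 0"
      unfolding Dop_DSop_commute[of Q] PQ(2) DSop.scale_minus_right DSop.scale_sum_right
      by (simp add: R0 flip: Dop_DSop_commute)
    thus "DSop (\<Prod>i<r. Ri i) w \<in> ?T" using PQ(1) by (auto simp: R_def intro: Dop.saturationI)
  qed
  moreover have "(\<Prod>i<r. Ri i) \<noteq> 0" using Ri(1) by auto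
  ultimately have ex: "\<exists>R. R \<noteq> 0 \<and> good R" by blast
  define R where "R = arg_min degree (\<lambda>R. R \<noteq> 0 \<and> good R)"
  have R: "R \<noteq> 0" "good R"
    using ex arg_min_natI[of "\<lambda>R. R \<noteq> 0 \<and> good R" _ degree] unfolding R_def by blast+
  have min: "degree R \<le> degree R'" if "R' \<noteq> 0" "good R'" for R'
    unfolding R_def by (rule arg_min_nat_le) (use that in auto)
  define R1 where "R1 = map_poly pderiv R + pCons 0 (pderiv R)"
  \<comment> \<open>\<open>R1\<close> is the commutator of \<open>R\<close> with multiplication by \<open>x\<close>.\<close>
  have good1: "good R1"
    unfolding good_def
  proof
    fix w assume w: "w \<in> L"
    have "[:0, 1:] \<odot> w \<in> L" using L(1) w by (rule subspace_scale)
    hence "DSop R ([:0, 1:] \<odot> w) - [:0, 1:] \<odot> DSop R w \<in> ?T"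
      using R(2) w by (intro Dop.subspace_diff[OF T] x_torsion) (auto simp: good_def)
    thus "DSop R1 w \<in> ?T" by (simp add: x_DSop R1_def)
  qed
  have coeff_R1: "coeff R1 j = pderiv (coeff R j) + of_nat j * coeff R j" for j
    by (cases j) (simp_all add: R1_def coeff_map_poly coeff_pderiv)
  define d where "d = degree R"
  \<comment> \<open>The combination in which the coefficients at \<open>S ^ d\<close> cancel;
    minimality of \<open>R\<close> then forces it to vanish.\<close>
  define R2 where "R2 = smult (coeff R d) R1 - smult (coeff R1 d) R"
  have good2: "good R2"
    unfolding good_def R2_def
    using good1 R(2)
    by (auto simp: good_def DSop.scale_left_diff_distrib Dop.op_poly_smult
             intro!: Dop.subspace_diff[OF T] Dop.subspace_scale[OF T])
  have "R2 = 0"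
  proof (rule ccontr)
    assume "R2 \<noteq> 0"
    hence "d \<le> degree R2" using min[OF _ good2] by (simp add: d_def)
    moreover have "coeff R2 j = 0" if "j \<ge> d" for j
    proof (cases "j = d")
      case False
      hence "coeff R j = 0" using that by (simp add: d_def coeff_eq_0)
      thus ?thesis by (simp add: R2_def coeff_R1)
    qed (simp add: R2_def mult.commute)
    ultimately show False using \<open>R2 \<noteq> 0\<close> leading_coeff_0_iff by blast
  qed
  have Rd: "coeff R d \<noteq> 0" using R(1) by (simp add: d_def)
  have Rj: "coeff R j = 0" if "j < d" for j
  proof (rule ccontr)
    define a b where "a = coeff R d" and "b = coeff R j"
    assume "coeff R j \<noteq> 0"
    hence b: "b \<noteq> 0" and a: "a \<noteq> 0" using Rd by (auto simp: a_def b_def)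
    \<comment> \<open>The degree of the left-hand side below is too small unless \<open>b = 0\<close>.\<close>
    have "coeff R2 j = 0" using \<open>R2 = 0\<close> by simp
    hence *: "a * pderiv b - pderiv a * b = of_nat (d - j) * (a * b)"
      using that by (simp add: R2_def coeff_R1 a_def b_def of_nat_diff algebra_simps)
    have ab: "of_nat (d - j) * (a * b) = smult (of_nat (d - j)) (a * b)"
      by (simp add: of_nat_poly)
    have "degree (of_nat (d - j) * (a * b)) = degree a + degree b"
      using that a b unfolding ab by (simp add: degree_mult_eq)
    moreover have "of_nat (d - j) * (a * b) \<noteq> 0" using that a b by simp
    ultimately have "degree (a * pderiv b - pderiv a * b) = degree a + degree b"
      and nz: "a * pderiv b - pderiv a * b \<noteq> 0" using * by metis+
    moreover have "degree (a * pderiv b - pderiv a * b) < degree a + degree b \<or> degree a + degree b = 0"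
    proof -
      have *: "degree (p * pderiv q) \<le> degree p + degree q - 1" for p q :: "complex poly"
      proof (cases "pderiv q = 0")
        case False
        hence "degree q \<noteq> 0" by (simp add: pderiv_eq_0_iff)
        thus ?thesis using degree_mult_le[of p "pderiv q"] by (simp add: degree_pderiv)
      qed simp
      have 1: "degree (a * pderiv b) \<le> degree a + degree b - 1" by (rule *)
      have 2: "degree (pderiv a * b) \<le> degree a + degree b - 1"
        using *[of b a] by (simp add: mult.commute add.commute)
      from degree_diff_le[OF 1 2] show ?thesis by linarith
    qed
    ultimately have "degree a = 0" "degree b = 0" by auto
    hence "pderiv a = 0" "pderiv b = 0" by (simp_all add: pderiv_eq_0_iff)
    with nz show False by simp
  qed
  have R_monom: "R = monom (coeff R d) d"
  proof (rule poly_eqI)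
    fix j show "coeff R j = coeff (monom (coeff R d) d) j"
      using Rj[of j] coeff_eq_0[of R j] by (cases j d rule: linorder_cases) (auto simp: d_def)
  qed
  show ?thesis
  proof
    fix w assume "w \<in> L"
    hence "Dop (coeff R d) ((S ^^ d) w) \<in> ?T"
      using R(2) unfolding good_def by (subst (asm) R_monom) (simp add: Dop.op_poly_monom)
    hence "(S ^^ d) w \<in> ?T" using Rd by (rule Dop.saturation_scaleD)
    then obtain P where P: "P \<noteq> 0" "Dop P ((S ^^ d) w) = 0"
      by (auto elim!: Dop.saturationE)
    have "(S ^^ d) (Dop P w) = Dop P ((S ^^ d) w)"
      by (induction d) (simp_all add: Dop.T_scale)
    hence "Dop P w = 0" using P(2) S_pow_eq_0 by metis
    thus "w \<in> ?T" using P(1) by (auto intro: Dop.saturationI)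
  qed
qed


section \<open>Degree filtration and finite rank over C[D]\<close>

text \<open>For finite \<open>G\<close>, a complex space of dimension at most
  \<open>card G * (d + 1)\<close>. These spaces exhaust \<open>span G\<close>, which turns questions
  of rank over C[D] into dimension counts over C.\<close>

definition poly_span :: "'m set \<Rightarrow> nat \<Rightarrow> 'm set" where
  "poly_span G d = const.span ((\<lambda>(j, g). monom 1 j \<odot> g) ` ({..d} \<times> G))"

lemma poly_span_mono: "d \<le> e \<Longrightarrow> poly_span G d \<subseteq> poly_span G e"
  unfolding poly_span_def by (intro const.span_mono) auto

lemma poly_span_generator:
  assumes "g \<in> G" "degree p \<le> d"
  shows "p \<odot> g \<in> poly_span G d"
proof -
  have "p = (\<Sum>i\<le>d. [:coeff p i:] * monom 1 i)"
    using poly_as_sum_of_monoms'[OF assms(2)] by (simp add: smult_monom)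
  hence "p \<odot> g = (\<Sum>i\<le>d. [:coeff p i:] \<odot> monom 1 i \<odot> g)"
    by (metis (no_types, lifting) scale_sum_left scale_scale sum.cong)
  also have "\<dots> \<in> poly_span G d"
    unfolding poly_span_def using assms by (intro const.span_sum const.span_scale const.span_base) auto
  finally show ?thesis .
qed

lemma poly_span_induct [consumes 1, case_names zero add scale]:
  assumes "v \<in> poly_span G d" "P 0" "\<And>x y. P x \<Longrightarrow> P y \<Longrightarrow> P (x + y)"
      and "\<And>c j g. j \<le> d \<Longrightarrow> g \<in> G \<Longrightarrow> P (monom c j \<odot> g)"
  shows "P v"
  using assms(1) unfolding poly_span_def
proof (induction rule: const.span_induct_alt)
  case (step c x y)
  then obtain j g where "j \<le> d" "g \<in> G" "x = monom 1 j \<odot> g" by auto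
  thus ?case using assms(3)[OF assms(4)[of j g c] step(2)] by (simp add: smult_monom)
qed (fact assms(2))

lemma poly_span_add: "x \<in> poly_span G d \<Longrightarrow> y \<in> poly_span G d \<Longrightarrow> x + y \<in> poly_span G d"
  unfolding poly_span_def by (rule const.span_add)

lemma poly_span_diff: "x \<in> poly_span G d \<Longrightarrow> y \<in> poly_span G d \<Longrightarrow> x - y \<in> poly_span G d"
  unfolding poly_span_def by (rule const.span_diff)

lemma poly_span_zero: "0 \<in> poly_span G d"
  unfolding poly_span_def by (rule const.span_zero)

lemma poly_span_scale:
  assumes "v \<in> poly_span G d" "degree p + d \<le> e" shows "p \<odot> v \<in> poly_span G e"
  using assms(1)
proof (induction rule: poly_span_induct)
  case (scale c j g)
  have "degree (p * monom c j) \<le> e"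
    using degree_mult_le[of p "monom c j"] degree_monom_le[of c j] scale assms(2) by linarith
  thus ?case using poly_span_generator[OF scale(2), of "p * monom c j" e] by simp
qed (simp_all add: poly_span_zero poly_span_add scale_right_distrib)

lemma ex_poly_span:
  assumes "v \<in> span G" shows "\<exists>d. v \<in> poly_span G d"
  using assms
proof (induction rule: span_induct_alt)
  case (step c x y)
  then obtain d where "y \<in> poly_span G d" by blast
  hence "y \<in> poly_span G (degree c + d)" using poly_span_mono[of d "degree c + d" G] by auto
  moreover have "c \<odot> x \<in> poly_span G (degree c + d)" by (rule poly_span_generator) (use step in auto)
  ultimately show ?case using poly_span_add by blast
qed (use poly_span_zero in auto)

lemma D_poly_span:
  assumes G: "finite G" and q: "\<And>v. v \<in> span G \<Longrightarrow> q \<odot> D v \<in> span G"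
  shows "\<exists>s. \<forall>d v. v \<in> poly_span G d \<longrightarrow> q \<odot> D v \<in> poly_span G (d + s)"
proof -
  have "\<forall>g\<in>G. \<exists>d. q \<odot> D g \<in> poly_span G d"
    using q ex_poly_span span_base by blast
  then obtain e where e: "\<And>g. g \<in> G \<Longrightarrow> q \<odot> D g \<in> poly_span G (e g)" by metis
  define s where "s = sum e G + degree q"
  have "q \<odot> D v \<in> poly_span G (d + s)" if "v \<in> poly_span G d" for d v
    using that
  proof (induction rule: poly_span_induct)
    case (scale c j g)
    have "degree (q * pderiv (monom c j)) \<le> d + s"
      using degree_mult_le[of q "pderiv (monom c j)"] degree_monom_le[of c j] scale(1)
      by (simp add: degree_pderiv s_def)
    hence 1: "(q * pderiv (monom c j)) \<odot> g \<in> poly_span G (d + s)"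
      by (rule poly_span_generator[OF scale(2)])
    have "e g \<le> s" unfolding s_def using member_le_sum[of g G e] G scale(2) by simp
    hence 2: "monom c j \<odot> (q \<odot> D g) \<in> poly_span G (d + s)"
      using degree_monom_le[of c j] scale(1) by (intro poly_span_scale[OF e[OF scale(2)]]) simp
    show ?case using poly_span_add[OF 1 2] by (simp add: D_scale scale_right_distrib mult.commute)
  qed (simp_all add: D.zero D_add scale_right_distrib poly_span_add poly_span_zero)
  thus ?thesis by blast
qed

lemma rank_bound:
  assumes G: "finite G" and q: "q \<noteq> 0" "\<And>v. v \<in> span G \<Longrightarrow> q \<odot> D v \<in> span G"
      and h: "h \<noteq> 0" "\<And>v. v \<in> L \<Longrightarrow> h \<odot> v \<in> span G"
  obtains K :: nat where "\<And>v. (\<And>i. i < K \<Longrightarrow> v i \<in> L) \<Longrightarrow>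
                  \<exists>P. (\<exists>i<K. P i \<noteq> 0) \<and> (\<Sum>i<K. Dop (P i) (v i)) = 0"
proof -
  obtain s where s: "\<And>d v. v \<in> poly_span G d \<Longrightarrow> q \<odot> D v \<in> poly_span G (d + s)"
    using D_poly_span[OF G q(2)] by blast
  define Q where "Q = q * h"
  define t where "t = s + degree h + degree Q + degree q"
  \<comment> \<open>The degree grows only linearly in \<open>a\<close>, whereas \<open>K\<close> vectors independent over \<open>Dop\<close>
    would give a space of dimension \<open>K * (N + 1)\<close>.\<close>
  have growth: "(Q ^ a * h) \<odot> (D ^^ a) v \<in> poly_span G (c + t * a)"
    if v: "h \<odot> v \<in> poly_span G c" for v c a
  proof (induction a)
    case (Suc a)
    define u where "u = (Q ^ a * h) \<odot> (D ^^ a) v"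
    have u: "u \<in> poly_span G (c + t * a)" using Suc by (simp add: u_def)
    \<comment> \<open>The correction from differentiating \<open>Q ^ a * h\<close> is, after
      multiplication by \<open>h * q\<close>, a multiple of that same factor. The cofactor
      \<open>p\<close> has degree bounded independently of \<open>a\<close>, which keeps the growth
      linear.\<close>
    define p where "p = of_nat a * pderiv Q + q * pderiv h"
    have "degree (of_nat a * pderiv Q) \<le> degree Q"
      using degree_mult_le[of "of_nat a" "pderiv Q"] by (simp add: degree_pderiv)
    moreover have "degree (q * pderiv h) \<le> degree q + degree h"
      using degree_mult_le[of q "pderiv h"] by (simp add: degree_pderiv)
    ultimately have "degree p \<le> t"
      unfolding p_def t_def by (intro degree_add_le) auto
    hence 1: "p \<odot> u \<in> poly_span G (c + t * Suc a)"
      by (intro poly_span_scale[OF u]) simp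
    have 2: "h \<odot> q \<odot> D u \<in> poly_span G (c + t * Suc a)"
      by (intro poly_span_scale[OF s[OF u]]) (simp add: t_def)
    have "h * (q * pderiv (Q ^ a * h)) = p * (Q ^ a * h)"
    proof -
      have "h * (q * pderiv (Q ^ a * h)) = Q * pderiv (Q ^ a) * h + Q * Q ^ a * pderiv h"
        by (simp add: pderiv_mult Q_def algebra_simps)
      also have "\<dots> = p * (Q ^ a * h)"
        by (simp add: times_pderiv_power p_def algebra_simps) (simp add: Q_def algebra_simps)
      finally show ?thesis .
    qed
    moreover have "h \<odot> q \<odot> D u =
        (h * (q * pderiv (Q ^ a * h))) \<odot> (D ^^ a) v + (h * (q * (Q ^ a * h))) \<odot> (D ^^ Suc a) v"
      by (simp only: u_def D_scale scale_right_distrib scale_scale funpow.simps o_apply)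
    moreover have "h * (q * (Q ^ a * h)) = Q ^ Suc a * h"
      by (simp add: Q_def mult_ac)
    ultimately have "h \<odot> q \<odot> D u - p \<odot> u = (Q ^ Suc a * h) \<odot> (D ^^ Suc a) v"
      by (simp only: u_def scale_scale add_diff_cancel_left')
    with poly_span_diff[OF 2 1] show ?case by simp
  qed (use v in simp)
  \<comment> \<open>One more than the growth rate \<open>card G * t\<close>, and independent of the
    vectors. Their starting degree \<open>c\<close> is absorbed by \<open>N\<close> below:
    \<open>K * (N + 1)\<close> exceeds \<open>card G * (c + t * N + 1)\<close> by
    \<open>card G * t + 1\<close>.\<close>
  define K where "K = card G * t + 1"
  show ?thesis
  proof (rule that[of K])
    fix v assume v: "\<And>i. i < K \<Longrightarrow> v i \<in> L"
    have "\<forall>i. i < K \<longrightarrow> (\<exists>c. h \<odot> v i \<in> poly_span G c)"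
      using ex_poly_span h(2) v by blast
    then obtain ci where ci: "\<And>i. i < K \<Longrightarrow> h \<odot> v i \<in> poly_span G (ci i)" by metis
    define c where "c = (\<Sum>i<K. ci i)"
    have c: "h \<odot> v i \<in> poly_span G c" if "i < K" for i
    proof -
      have "ci i \<le> c" unfolding c_def using that by (intro member_le_sum) auto
      thus ?thesis using ci[OF that] poly_span_mono by blast
    qed
    define N where "N = card G * (c + 1)"
    \<comment> \<open>All derivatives get the same multiplier \<open>Q ^ N * h\<close>, so that
      torsion-freeness can cancel it from a linear relation.\<close>
    define w where "w = (\<lambda>(i, a). (Q ^ N * h) \<odot> (D ^^ a) (v i))"
    have w: "w ` ({..<K} \<times> {..N}) \<subseteq> poly_span G (c + t * N)"
    proof
      fix x assume "x \<in> w ` ({..<K} \<times> {..N})"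
      then obtain i a where ia: "i < K" "a \<le> N" "x = w (i, a)" by auto
      have "degree (Q ^ (N - a)) \<le> degree Q * (N - a)" by (rule degree_power_le)
      also have "\<dots> \<le> t * (N - a)" by (simp add: t_def)
      finally have "degree (Q ^ (N - a)) + (c + t * a) \<le> t * (N - a) + (c + t * a)" by simp
      also have "\<dots> = c + t * (N - a + a)" by (simp only: distrib_left add_ac)
      finally have "degree (Q ^ (N - a)) + (c + t * a) \<le> c + t * N" using ia by simp
      hence "Q ^ (N - a) \<odot> (Q ^ a * h) \<odot> (D ^^ a) (v i) \<in> poly_span G (c + t * N)"
        using ia by (intro poly_span_scale[OF growth[OF c]]) auto
      moreover have "Q ^ (N - a) * (Q ^ a * h) = Q ^ N * h"
        using ia by (simp flip: power_add mult.assoc)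
      ultimately show "x \<in> poly_span G (c + t * N)" by (simp add: w_def ia)
    qed
    have "card ((\<lambda>(j, g). monom 1 j \<odot> g) ` ({..c + t * N} \<times> G)) \<le> card ({..c + t * N} \<times> G)"
      by (rule card_image_le) (use G in auto)
    also have "\<dots> < card ({..<K} \<times> {..N})"
      by (simp add: card_cartesian_product) (simp add: K_def N_def algebra_simps)
    finally have "\<exists>b. (\<exists>i\<in>{..<K} \<times> {..N}. b i \<noteq> 0) \<and> (\<Sum>i\<in>{..<K} \<times> {..N}. [:b i:] \<odot> w i) = 0"
      using w G by (intro const.dependent_family) (auto simp: poly_span_def)
    then obtain b i a where b: "i < K" "a \<le> N" "b (i, a) \<noteq> 0"
      and sum: "(\<Sum>i\<in>{..<K} \<times> {..N}. [:b i:] \<odot> w i) = 0" by auto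
    define P where "P = (\<lambda>i. \<Sum>a\<le>N. monom (b (i, a)) a)"
    have "coeff (P i) a = b (i, a)"
      unfolding P_def using b(2) by (subst coeff_sum) (simp add: if_distrib cong: if_cong)
    hence "P i \<noteq> 0" using b(3) by auto
    moreover have "(\<Sum>i<K. Dop (P i) (v i)) = 0"
    proof -
      have "0 = (\<Sum>i<K. \<Sum>a\<le>N. [:b (i, a):] \<odot> (Q ^ N * h) \<odot> (D ^^ a) (v i))"
        using sum by (simp add: w_def sum.cartesian_product case_prod_unfold)
      also have "\<dots> = (Q ^ N * h) \<odot> (\<Sum>i<K. \<Sum>a\<le>N. [:b (i, a):] \<odot> (D ^^ a) (v i))"
        unfolding scale_sum_right by (intro sum.cong refl scale_left_commute)
      also have "(\<Sum>i<K. \<Sum>a\<le>N. [:b (i, a):] \<odot> (D ^^ a) (v i)) = (\<Sum>i<K. Dop (P i) (v i))"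
        by (simp add: P_def Dop.scale_sum_left const.op_poly_monom)
      finally show ?thesis using torsion_free[of "Q ^ N * h"] q(1) h(1) by (auto simp: Q_def)
    qed
    ultimately show "\<exists>P. (\<exists>i<K. P i \<noteq> 0) \<and> (\<Sum>i<K. Dop (P i) (v i)) = 0"
      using b(1) by blast
  qed
qed

section \<open>From the two given equations to one with constant coefficients\<close>

text \<open>The two equations make the span of the D^i S^j f stable up to denominators. The converse
  condition, that this span is covered by its own image under \<open>S\<close>, comes from a
  difference relation with nonzero constant term, solved for \<open>f\<close>.\<close>

theorem constant_coefficients:
  assumes A: "A n \<noteq> 0" "(\<Sum>i\<le>n. A i \<odot> (D ^^ i) f) = 0"
      and B: "B l \<noteq> 0" "(\<Sum>j\<le>l. B j \<odot> (S ^^ j) f) = 0"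
  obtains h P where "h \<noteq> 0" "P \<noteq> 0" "Dop P (h \<odot> f) = 0"
proof (cases "f = 0")
  case True
  thus ?thesis using that[of 1 1] by simp
next
  case f: False
  have n: "n > 0" using A f torsion_free[of "A 0" f] by (intro Nat.gr0I) auto
  define Q where "Q = (\<lambda>l. \<exists>B. B l \<noteq> 0 \<and> (\<Sum>j\<le>l. B j \<odot> (S ^^ j) f) = 0)"
  have "Q l" using B by (auto simp: Q_def)
  define m where "m = (LEAST l. Q l)"
  have "Q m" unfolding m_def by (rule LeastI) fact
  then obtain C where C: "C m \<noteq> 0" "(\<Sum>j\<le>m. C j \<odot> (S ^^ j) f) = 0" by (auto simp: Q_def)
  have m: "m > 0" using C f torsion_free[of "C 0" f] by (intro Nat.gr0I) auto
  \<comment> \<open>Otherwise \<open>S\<close> could be cancelled from the relation, against the minimality of \<open>m\<close>.\<close>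
  have C0: "C 0 \<noteq> 0"
  proof
    assume C0: "C 0 = 0"
    from m obtain k where k: "m = Suc k" by (cases m) auto
    define C' where "C' = (\<lambda>j. pcompose (C (Suc j)) [:-1, 1:])"
    have C': "pcompose (C' j) [:1, 1:] = C (Suc j)" for j
      unfolding C'_def by (simp flip: pcompose_assoc add: pcompose_pCons)
    have "S (\<Sum>j\<le>k. C' j \<odot> (S ^^ j) f) = (\<Sum>j\<le>k. C (Suc j) \<odot> (S ^^ Suc j) f)"
      by (simp add: S.sum S_scale C')
    also have "\<dots> = (\<Sum>j\<le>m. C j \<odot> (S ^^ j) f)"
      unfolding k sum.atMost_Suc_shift by (simp add: C0)
    finally have "(\<Sum>j\<le>k. C' j \<odot> (S ^^ j) f) = 0" using C(2) S_eq_0 by simp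
    moreover have "C' k \<noteq> 0" using C(1) C'[of k] k by auto
    ultimately have "Q k" by (auto simp: Q_def)
    hence "m \<le> k" unfolding m_def by (rule Least_le)
    with k show False by simp
  qed
  define G where "G = (\<lambda>(i, j). (D ^^ i) ((S ^^ j) f)) ` ({..<n} \<times> {..<m})"
  define E where "E = span G"
  have E: "subspace E" by (simp add: E_def)
  have G: "finite G" by (simp add: G_def)
  have base: "(D ^^ i) ((S ^^ j) f) \<in> E" if "i < n" "j < m" for i j
    unfolding E_def by (rule span_base) (use that in \<open>auto simp: G_def\<close>)
  \<comment> \<open>\<open>S ^^ j\<close> carries the differential equation of \<open>f\<close> to
    one for \<open>(S ^^ j) f\<close> with shifted coefficients and the same order.\<close>
  have top: "(D ^^ n) ((S ^^ j) f) \<in> saturation E" if j: "j < m" for j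
  proof -
    define A' where "A' = (\<lambda>i. pcompose (A i) [:of_nat j, 1:])"
    have S_pow_sum: "(S ^^ j) (\<Sum>i\<in>I. w i) = (\<Sum>i\<in>I. (S ^^ j) (w i))" for I :: "nat set" and w
      by (induction I rule: infinite_finite_induct) (simp_all add: S_pow_0 S_pow_add)
    have "0 = (S ^^ j) (\<Sum>i\<le>n. A i \<odot> (D ^^ i) f)" using A S_pow_0 by simp
    also have "\<dots> = (\<Sum>i\<le>n. A' i \<odot> (D ^^ i) ((S ^^ j) f))"
      by (simp add: S_pow_sum S_pow_scale A'_def S_pow_D_pow)
    also have "\<dots> = (\<Sum>i<n. A' i \<odot> (D ^^ i) ((S ^^ j) f)) + A' n \<odot> (D ^^ n) ((S ^^ j) f)"
      by (simp add: lessThan_Suc_atMost[symmetric])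
    finally have "A' n \<odot> (D ^^ n) ((S ^^ j) f) = - (\<Sum>i<n. A' i \<odot> (D ^^ i) ((S ^^ j) f))"
      by (metis add.commute eq_neg_iff_add_eq_0)
    also have "\<dots> \<in> E"
      using base j by (intro subspace_neg[OF E] subspace_sum[OF E] subspace_scale[OF E base]) auto
    finally show ?thesis using A(1) by (auto intro: saturationI simp: A'_def shift_neq_0)
  qed
  have D_G: "D ` G \<subseteq> saturation E"
  proof -
    have "D ((D ^^ i) ((S ^^ j) f)) \<in> saturation E" if "i < n" "j < m" for i j
    proof (cases "Suc i = n")
      case True
      thus ?thesis using top[OF that(2)] by auto
    next
      case False
      thus ?thesis using base[of "Suc i" j] that saturation_superset by auto
    qed
    thus ?thesis by (auto simp: G_def)
  qed
  obtain q where q: "q \<noteq> 0" "\<And>v. v \<in> E \<Longrightarrow> q \<odot> D v \<in> E"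
    using common_denominator_D[OF G D_G[unfolded E_def]] unfolding E_def by blast
  have D_sat1: "D v \<in> saturation E" if "v \<in> E" for v
    using q(2)[OF that] q(1) by (rule saturationI)
  have D_sat: "(D ^^ i) v \<in> saturation E" if "v \<in> saturation E" for i v
    using that by (induction i) (auto intro: D_saturation[OF E D_sat1])
  have Sm: "(S ^^ m) f \<in> saturation E"
  proof -
    have "C m \<odot> (S ^^ m) f = - (\<Sum>j<m. C j \<odot> (S ^^ j) f)"
      using C(2) by (simp add: lessThan_Suc_atMost[symmetric]) (metis add.commute eq_neg_iff_add_eq_0)
    also have "\<dots> \<in> E"
      using base[of 0] n by (intro subspace_neg[OF E] subspace_sum[OF E] subspace_scale[OF E]) auto
    finally show ?thesis using C(1) by (rule saturationI)
  qed
  have S_G: "S ` G \<subseteq> saturation E"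
  proof -
    have "S ((D ^^ i) ((S ^^ j) f)) \<in> saturation E" if "i < n" "j < m" for i j
    proof (cases "Suc j = m")
      case True
      thus ?thesis using D_sat[OF Sm, of i] S_pow_D_pow[of 1 i "(S ^^ j) f"] by auto
    next
      case False
      thus ?thesis using base[of i "Suc j"] that saturation_superset S_pow_D_pow[of 1 i "(S ^^ j) f"] by auto
    qed
    thus ?thesis by (auto simp: G_def)
  qed
  define F where "F = S ` E"
  have F: "subspace F" using subspace_S_pow[OF E, of 1] by (simp add: F_def)
  \<comment> \<open>With \<open>F\<close> stable under \<open>D\<close> up to denominators, only the
    shifts of \<open>f\<close> have to be placed in its saturation; their derivatives
    follow.\<close>
  have "D v \<in> saturation F" if v: "v \<in> F" for v
  proof -
    obtain e where e: "e \<in> E" "v = S e" using v by (auto simp: F_def)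
    have "S (q \<odot> D e) \<in> F" unfolding F_def using q(2)[OF e(1)] by (rule imageI)
    hence "pcompose q [:1, 1:] \<odot> D v \<in> F" by (simp add: S_scale e D_S)
    thus ?thesis using shift_neq_0[OF q(1)] by (rule saturationI)
  qed
  hence D_sat_F: "(D ^^ i) v \<in> saturation F" if "v \<in> saturation F" for i v
    using that by (induction i) (auto intro: D_saturation[OF F])
  have S_F: "(S ^^ Suc j) f \<in> F" if "j < m" for j
    unfolding F_def using base[of 0 j] n that by auto
  have "f \<in> saturation F"
  proof -
    from m obtain k where k: "m = Suc k" by (cases m) auto
    have "C 0 \<odot> f = - (\<Sum>j\<le>k. C (Suc j) \<odot> (S ^^ Suc j) f)"
      using C(2) unfolding k by (subst (asm) sum.atMost_Suc_shift) (simp add: eq_neg_iff_add_eq_0)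
    also have "\<dots> \<in> F"
      using S_F k by (intro subspace_neg[OF F] subspace_sum[OF F] subspace_scale[OF F]) auto
    finally show ?thesis using C0 by (rule saturationI)
  qed
  hence "(S ^^ j) f \<in> saturation F" if "j < m" for j
  proof (cases j)
    case (Suc i)
    thus ?thesis using S_F[of i] saturation_superset[of F] that by auto
  qed (use \<open>f \<in> saturation F\<close> in simp)
  hence G_F: "G \<subseteq> saturation F" by (auto simp: G_def intro: D_sat_F)
  obtain L h where L: "h \<noteq> 0" "subspace L" "D ` L \<subseteq> L" "S ` L \<subseteq> L"
      "\<And>v. v \<in> L \<Longrightarrow> h \<odot> v \<in> E" "\<And>v. v \<in> E \<Longrightarrow> h \<odot> v \<in> L"
    using ex_stable_lattice[OF G D_G[unfolded E_def] S_G[unfolded E_def] G_F[unfolded F_def E_def]]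
    unfolding E_def by blast
  obtain K :: nat where K: "\<And>v. (\<And>i. i < K \<Longrightarrow> v i \<in> L) \<Longrightarrow>
                  \<exists>P. (\<exists>i<K. P i \<noteq> 0) \<and> (\<Sum>i<K. Dop (P i) (v i)) = 0"
    using rank_bound[OF G q(1) q(2)[unfolded E_def] L(1) L(5)[unfolded E_def]] by blast
  have "L \<subseteq> Dop.saturation {0}"
    using L(2-4) K by (rule torsion_of_rank_bound)
  moreover have "h \<odot> f \<in> L" using base[of 0 0] n m by (intro L(6)) simp
  ultimately obtain P where "P \<noteq> 0" "Dop P (h \<odot> f) = 0" by (auto elim!: Dop.saturationE)
  thus ?thesis using that L(1) by blast
qed

end

section \<open>Solving equations with constant coefficients\<close>

lemma (in module_endo) op_poly_linear: "op_poly scale T [:a, 1:] v = T v + a \<odot> v"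
  by (simp add: op_poly_pCons op_poly_0 T.zero add.commute)

text \<open>Reduces P(T) v = 0 to first-order equations: over C one linear factor is peeled off at a
  time, and \<open>Z\<close> absorbs the inhomogeneous terms that arise.\<close>

lemma op_poly_root_induct:
  fixes s :: "complex \<Rightarrow> 'm \<Rightarrow> 'm::ab_group_add"
  assumes "module_endo s T" "P \<noteq> 0" "op_poly s T P v = 0" "0 \<in> Z"
      and Z: "\<And>a v. T v - s a v \<in> Z \<Longrightarrow> v \<in> Z"
  shows "v \<in> Z"
  using assms(2,3)
proof (induction "degree P" arbitrary: P v)
  case 0
  interpret module_endo s T by fact
  from 0 obtain c where c: "P = [:c:]" "c \<noteq> 0" by (metis degree_eq_zeroE pCons_0_0)
  have "v = s (1 / c) (s c v)" using c by simp
  also have "s c v = 0" using 0 c by (simp add: op_poly_pCons op_poly_0 T.zero)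
  finally show ?case using assms(4) by simp
next
  case (Suc n)
  interpret module_endo s T by fact
  have "\<not>constant (poly P)" using Suc(2) by (simp add: constant_degree)
  then obtain a where "poly P a = 0" using fundamental_theorem_of_algebra by blast
  then obtain Q where Q: "P = [:-a, 1:] * Q" by (auto simp: poly_eq_0_iff_dvd elim: dvdE)
  have "Q \<noteq> 0" using Q Suc.prems by auto
  moreover from this have "n = degree Q" using Suc(2) unfolding Q by (subst (asm) degree_mult_eq) auto
  moreover have "op_poly s T Q (op_poly s T [:-a, 1:] v) = 0"
    using Suc.prems(2) unfolding Q by (metis mult.commute op_poly_mult)
  ultimately have "op_poly s T [:-a, 1:] v \<in> Z" by (intro Suc.hyps(1))
  thus ?case by (intro Z[of v a]) (simp add: op_poly_linear)
qed

text \<open>For nonzero \<open>a\<close>, d/dx + a is invertible on polynomials because d/dx is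
  nilpotent in bounded degree; a solution for p' yields one for p. For \<open>a = 0\<close> this is
  integration.\<close>

lemma ex_pderiv_add_smult_eq:
  fixes p :: "'a::field_char_0 poly"
  shows "\<exists>r. pderiv r + smult a r = p"
proof (cases "a = 0")
  case False
  show ?thesis
  proof (induction "degree p" arbitrary: p rule: less_induct)
    case less
    show ?case
    proof (cases "degree p = 0")
      case True
      thus ?thesis using False by (intro exI[of _ "smult (1 / a) p"]) (simp add: pderiv_smult pderiv_eq_0_iff)
    next
      case deg: False
      hence "degree (pderiv p) < degree p" by (simp add: degree_pderiv)
      then obtain r where r: "pderiv r + smult a r = pderiv p" using less by blast
      have "pderiv (smult (1 / a) (p - r)) + smult a (smult (1 / a) (p - r)) =
            smult (1 / a) (pderiv p - pderiv r) + (p - r)"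
        using False by (simp add: pderiv_smult pderiv_diff)
      also have "pderiv p - pderiv r = smult a r" using r by (simp add: algebra_simps)
      also have "smult (1 / a) (smult a r) + (p - r) = p" using False by simp
      finally show ?thesis by blast
    qed
  qed
next
  case True
  have "\<exists>r. pderiv r = p"
  proof -
    define r where "r = (\<Sum>i\<le>degree p. monom (coeff p i / of_nat (Suc i)) (Suc i))"
    have "pderiv r = (\<Sum>i\<le>degree p. monom (coeff p i) i)"
      unfolding r_def by (simp add: higher_pderiv_sum[of 1, simplified] pderiv_monom del: of_nat_Suc)
    thus ?thesis by (auto simp: poly_as_sum_of_monoms)
  qed
  thus ?thesis using True by simp
qed

lemma ratfun_common_denominator:
  fixes a :: "nat \<Rightarrow> ratfun"
  shows "\<exists>p q. q \<noteq> 0 \<and> (\<forall>i<n. a i = Fract (p i) q)"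
proof (induction n)
  case (Suc n)
  then obtain p q where pq: "q \<noteq> 0" "\<And>i. i < n \<Longrightarrow> a i = Fract (p i) q" by blast
  obtain u v where uv: "a n = Fract u v" "v \<noteq> 0" by (cases "a n")
  have "a i = Fract (if i = n then u * q else p i * v) (q * v)" if "i < Suc n" for i
  proof (cases "i = n")
    case True
    thus ?thesis using pq uv by (simp add: eq_fract)
  next
    case False
    hence "a i = Fract (p i) q" using that pq by simp
    thus ?thesis using pq uv False by (simp add: eq_fract)
  qed
  thus ?case using pq uv by (intro exI[of _ "\<lambda>i. if i = n then u * q else p i * v"] exI[of _ "q * v"]) simp
qed (auto intro: exI[of _ 1])

section \<open>Laurent series in the reciprocal of x\<close>

text \<open>A power of X turns \<open>F\<close> into a power series, where the chain rule is
  available; the product rule then removes that power again.\<close>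

lemma fls_deriv_compose:
  fixes F :: "complex fls"
  assumes G: "G \<noteq> 0" "fps_nth G 0 = 0"
  shows "fls_deriv (fls_compose_fps F G) = fls_compose_fps (fls_deriv F) G * fls_deriv (fps_to_fls G)"
proof -
  have fps: "fls_deriv (fls_compose_fps (fps_to_fls H) G) =
      fls_compose_fps (fls_deriv (fps_to_fls H)) G * fls_deriv (fps_to_fls G)" for H
    using G fps_compose_deriv[OF G(2), of H] by (simp add: fls_deriv_fps_to_fls fls_times_fps_to_fls)
  define n where "n = nat (- fls_subdegree F)"
  define X where "X = fps_to_fls (fps_X ^ n :: complex fps)"
  have "F * X = fps_to_fls (fls_regpart (F * X))"
    by (cases "F = 0") (simp_all add: X_def n_def fps_to_fls_power fls_X_power_conv_shift_1)
  then obtain H where H: "F * X = fps_to_fls H" by blast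
  let ?c = "\<lambda>F. fls_compose_fps F G" and ?G' = "fls_deriv (fps_to_fls G)"
  have "fls_deriv (?c F) * ?c X + ?c F * fls_deriv (?c X) = fls_deriv (?c (F * X))"
    using G by (simp add: fls_compose_fps_mult)
  also have "\<dots> = ?c (fls_deriv (F * X)) * ?G'" unfolding H by (rule fps)
  also have "\<dots> = ?c (fls_deriv F) * ?G' * ?c X + ?c F * (?c (fls_deriv X) * ?G')"
    using G by (simp add: fls_compose_fps_mult fls_compose_fps_add algebra_simps)
  also have "?c (fls_deriv X) * ?G' = fls_deriv (?c X)" unfolding X_def by (rule fps[symmetric])
  finally have "fls_deriv (?c F) * ?c X = ?c (fls_deriv F) * ?G' * ?c X" by simp
  moreover have "?c X \<noteq> 0" using G by (subst fls_compose_fps_eq_0_iff) (auto simp: X_def)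
  ultimately show ?thesis by simp
qed

abbreviation (input) fps_shift_inv :: "complex fps" where
  "fps_shift_inv \<equiv> fps_X / (1 + fps_X)"

lemma fps_shift_inv: "fps_shift_inv * (1 + fps_X) = fps_X"
  by (subst fps_divide_unit) (simp_all add: mult.assoc inverse_mult_eq_1)

lemma fps_shift_inv_nz: "fps_shift_inv \<noteq> 0" "fps_nth fps_shift_inv 0 = 0"
proof -
  show "fps_shift_inv \<noteq> 0" using fps_shift_inv by (metis fps_X_neq_zero mult_zero_left)
  have "fps_nth (fps_shift_inv * (1 + fps_X)) 0 = 0" unfolding fps_shift_inv by simp
  thus "fps_nth fps_shift_inv 0 = 0" by simp
qed

lemma fls_sigma_add: "fls_sigma (v + w) = fls_sigma v + fls_sigma w"
  unfolding fls_sigma_def by (rule fls_compose_fps_add[OF fps_shift_inv_nz])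

lemma fls_sigma_mult: "fls_sigma (v * w) = fls_sigma v * fls_sigma w"
  unfolding fls_sigma_def by (rule fls_compose_fps_mult[OF fps_shift_inv_nz])

lemma fls_sigma_const: "fls_sigma (fls_const c) = fls_const c"
  by (simp add: fls_sigma_def)

lemma fls_sigma_poly: "fls_sigma (poly_expansion p) = poly_expansion (pcompose p [:1, 1:])"
proof (induction p)
  case (pCons c p)
  have "poly_expansion [:1, 1:] = fls_X_inv + 1"
    by (simp add: poly_expansion_pCons poly_expansion_0 add.commute)
  with pCons show ?case
    by (simp add: poly_expansion_pCons fls_sigma_add fls_sigma_mult fls_sigma_const fls_sigma_x
          pcompose_pCons poly_expansion_add poly_expansion_mult poly_expansion_0 distrib_right add_ac)
qed (simp add: poly_expansion_0 fls_sigma_def)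

lemma fls_delta_add: "fls_delta (v + w) = fls_delta v + fls_delta w"
  by (simp add: fls_delta_def algebra_simps)

lemma fls_delta_mult: "fls_delta (v * w) = fls_delta v * w + v * fls_delta w"
  by (simp add: fls_delta_def algebra_simps)

lemma fls_delta_const: "fls_delta (fls_const c) = 0"
  by (simp add: fls_delta_def)

lemma fls_delta_poly: "fls_delta (poly_expansion p) = poly_expansion (pderiv p)"
proof (induction p)
  case (pCons c p)
  thus ?case
    by (simp add: poly_expansion_pCons fls_delta_add fls_delta_mult fls_delta_const fls_delta_x
          pderiv_pCons poly_expansion_add poly_expansion_0)
qed (simp add: poly_expansion_0 fls_delta_def)

text \<open>With G = t/(1 + t) this comes down to t^2 G' = G^2, which says that 1/G = 1/t + 1 and
  1/t have the same derivative.\<close>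

lemma fls_delta_sigma: "fls_delta (fls_sigma v) = fls_sigma (fls_delta v)"
proof -
  let ?G = fps_shift_inv
  have "(1 + fps_X) * fps_deriv (?G * (1 + fps_X)) = 1 + fps_X"
    by (subst fps_shift_inv) simp
  hence "(1 + fps_X) ^ 2 * fps_deriv ?G + ?G * (1 + fps_X) = 1 + fps_X"
    by (simp add: algebra_simps power2_eq_square)
  hence "(1 + fps_X) ^ 2 * fps_deriv ?G = 1"
    unfolding fps_shift_inv by (simp add: algebra_simps)
  hence "?G ^ 2 * ((1 + fps_X) ^ 2 * fps_deriv ?G) = ?G ^ 2" by simp
  moreover have "?G ^ 2 * ((1 + fps_X) ^ 2 * fps_deriv ?G) = fps_X ^ 2 * fps_deriv ?G"
    using fps_shift_inv by (metis mult.assoc power_mult_distrib)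
  ultimately have "fps_X ^ 2 * fps_deriv ?G = ?G ^ 2" by simp
  from arg_cong[OF this, of fps_to_fls]
  have "fls_X ^ 2 * fls_deriv (fps_to_fls ?G) = fps_to_fls ?G ^ 2"
    by (simp add: fls_times_fps_to_fls fps_to_fls_power fls_deriv_fps_to_fls)
  moreover have "fls_compose_fps (fls_X ^ 2) ?G = fps_to_fls ?G ^ 2"
    using fls_compose_fps_power[OF fps_shift_inv_nz] by simp
  ultimately have *: "fls_X ^ 2 * fls_deriv (fps_to_fls ?G) = fls_compose_fps (fls_X ^ 2) ?G" by simp
  have "fls_delta (fls_sigma v) =
      - (fls_X ^ 2 * fls_deriv (fps_to_fls ?G) * fls_compose_fps (fls_deriv v) ?G)"
    unfolding fls_delta_def fls_sigma_def fls_deriv_compose[OF fps_shift_inv_nz] by (simp only: mult_ac)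
  also have "\<dots> = fls_sigma (fls_delta v)"
    unfolding * fls_delta_def fls_sigma_def
    by (simp only: fls_compose_fps_mult[OF fps_shift_inv_nz] fls_compose_fps_uminus)
  finally show ?thesis .
qed

lemma delta_sigma_module_fls:
  "delta_sigma_module (\<lambda>p v. poly_expansion p * v) fls_delta fls_sigma"
proof unfold_locales
  show "poly_expansion 1 * x = x" for x
    by (simp add: one_pCons poly_expansion_pCons poly_expansion_0)
  show "v = 0" if "fls_sigma v = 0" for v
    using that fls_compose_fps_eq_0_iff[OF fps_shift_inv_nz] by (simp add: fls_sigma_def)
qed (auto simp: algebra_simps poly_expansion_add poly_expansion_mult poly_expansion_eq_0_iff
       fls_delta_add fls_delta_mult fls_delta_poly fls_sigma_add fls_sigma_mult fls_sigma_poly fls_delta_sigma)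

lemma poly_expansion_diff: "poly_expansion (p - q) = poly_expansion p - poly_expansion q"
  by (rule fls_eqI) (simp add: poly_expansion_nth)

lemma poly_expansionI:
  includes fps_syntax
  assumes "\<And>n. n > 0 \<Longrightarrow> v $$ n = 0"
  shows "v \<in> range poly_expansion"
proof -
  define N where "N = nat (- fls_subdegree v)"
  define p where "p = (\<Sum>i\<le>N. monom (v $$ (- int i)) i)"
  have coeff: "coeff p i = (if i \<le> N then v $$ (- int i) else 0)" for i
    by (simp add: p_def coeff_sum if_distrib cong: if_cong)
  have "v = poly_expansion p"
  proof (rule fls_eqI)
    fix n
    have "v $$ n = 0" if "nat (- n) > N" 
      using that by (intro fls_eq0_below_subdegree) (simp add: N_def)
    thus "v $$ n = poly_expansion p $$ n"
      using assms[of n] by (auto simp: poly_expansion_nth coeff)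
  qed
  thus ?thesis by blast
qed

text \<open>For \<open>a = 0\<close>, a negative power of x in \<open>v\<close> would leave a
  negative power in the derivative. Otherwise a polynomial particular solution is subtracted, and w'
  = a w has only the zero solution: d/dx raises the order in 1/x, so the lowest term of a w is
  unmatched. This is why no exponentials survive here.\<close>

lemma poly_expansion_of_delta:
  includes fps_syntax
  assumes "fls_delta v - poly_expansion [:a:] * v \<in> range poly_expansion"
  shows "v \<in> range poly_expansion"
proof (cases "a = 0")
  case True
  then obtain p where p: "fls_delta v = poly_expansion p"
    using assms by (auto simp: poly_expansion_0)
  show ?thesis
  proof (rule poly_expansionI)
    fix n :: int assume n: "n > 0"
    have "fls_delta v $$ (n + 1) = 0" using n by (simp add: p poly_expansion_nth)
    thus "v $$ n = 0" using n by (simp add: fls_delta_nth)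
  qed
next
  case False
  from assms obtain p where p: "fls_delta v - poly_expansion [:a:] * v = poly_expansion p" by auto
  obtain r where r: "pderiv r + smult (-a) r = p" using ex_pderiv_add_smult_eq by blast
  define w where "w = v - poly_expansion r"
  have c: "poly_expansion [:a:] = fls_const a" by (simp add: poly_expansion_pCons poly_expansion_0)
  have vw: "v = w + poly_expansion r" by (simp add: w_def)
  have pr: "poly_expansion p = poly_expansion (pderiv r) - fls_const a * poly_expansion r"
    unfolding r[symmetric] by (simp add: poly_expansion_diff poly_expansion_smult)
  hence w: "fls_delta w = fls_const a * w"
    using p unfolding vw c pr by (simp add: fls_delta_add fls_delta_poly algebra_simps)
  have "w = 0"
  proof (rule ccontr)
    assume "w \<noteq> 0"
    hence "w $$ fls_subdegree w \<noteq> 0" by simp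
    moreover have "a * w $$ fls_subdegree w = - of_int (fls_subdegree w - 1) * w $$ (fls_subdegree w - 1)"
      using arg_cong[OF w, of "\<lambda>w'. w' $$ fls_subdegree w"] by (simp add: fls_delta_nth)
    ultimately show False using False by simp
  qed
  thus ?thesis by (simp add: vw)
qed

theorem fls_rational:
  assumes "(fls_delta ^^ n) f + (\<Sum>i<n. ratfun_expansion (a i) * (fls_delta ^^ i) f) = 0"
      and "(fls_sigma ^^ l) f + (\<Sum>i<l. ratfun_expansion (b i) * (fls_sigma ^^ i) f) = 0"
  shows "f \<in> range ratfun_expansion"
proof -
  interpret delta_sigma_module "\<lambda>p v. poly_expansion p * v" fls_delta fls_sigma
    by (rule delta_sigma_module_fls)
  have clear: "\<exists>A. A n \<noteq> 0 \<and> (\<Sum>i\<le>n. poly_expansion (A i) * w i) = 0"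
    if "w n + (\<Sum>i<n. ratfun_expansion (a i) * w i) = 0" for n :: nat and a and w :: "nat \<Rightarrow> complex fls"
  proof -
    obtain p q where pq: "q \<noteq> 0" "\<And>i. i < n \<Longrightarrow> a i = Fract (p i) q"
      using ratfun_common_denominator[of n a] by blast
    define A where "A = (\<lambda>i. if i < n then p i else q)"
    have "(\<Sum>i\<le>n. poly_expansion (A i) * w i) = poly_expansion q * w n + (\<Sum>i<n. poly_expansion (p i) * w i)"
      by (simp add: lessThan_Suc_atMost[symmetric] A_def)
    also have "(\<Sum>i<n. poly_expansion (p i) * w i) =
        poly_expansion q * (\<Sum>i<n. ratfun_expansion (a i) * w i)"
      unfolding sum_distrib_left
    proof (rule sum.cong)
      fix i assume "i \<in> {..<n}"
      hence "ratfun_expansion (a i) = poly_expansion (p i) / poly_expansion q"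
        using pq by (simp add: ratfun_expansion_Fract)
      moreover have "poly_expansion q \<noteq> 0" using pq(1) by (simp add: poly_expansion_eq_0_iff)
      ultimately show "poly_expansion (p i) * w i = poly_expansion q * (ratfun_expansion (a i) * w i)"
        by (simp add: mult.assoc[symmetric])
    qed simp
    also have "poly_expansion q * w n + \<dots> = 0" using that by (simp flip: distrib_left)
    finally show ?thesis using pq(1) by (intro exI[of _ A]) (simp add: A_def)
  qed
  obtain A where A: "A n \<noteq> 0" "(\<Sum>i\<le>n. poly_expansion (A i) * (fls_delta ^^ i) f) = 0"
    using clear[of "\<lambda>i. (fls_delta ^^ i) f" n a] assms(1) by auto
  obtain B where B: "B l \<noteq> 0" "(\<Sum>i\<le>l. poly_expansion (B i) * (fls_sigma ^^ i) f) = 0"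
    using clear[of "\<lambda>i. (fls_sigma ^^ i) f" l b] assms(2) by auto
  obtain h P where hP: "h \<noteq> 0" "P \<noteq> 0" "Dop P (poly_expansion h * f) = 0"
    using constant_coefficients[OF A B] .
  have "poly_expansion h * f \<in> range poly_expansion"
  proof (rule op_poly_root_induct[OF const.module_endo_axioms hP(2,3)])
    show "0 \<in> range poly_expansion" by (metis poly_expansion_0 rangeI)
  qed (rule poly_expansion_of_delta)
  then obtain p where "poly_expansion h * f = poly_expansion p" by auto
  hence "f = ratfun_expansion (Fract p h)"
    using hP(1) by (simp add: ratfun_expansion_Fract poly_expansion_eq_0_iff field_simps)
  thus ?thesis by blast
qed

section \<open>Meromorphic functions on a strip\<close>

definition germ_poly :: "complex \<Rightarrow> complex poly \<Rightarrow> complex fls" where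
  "germ_poly z p = fps_to_fls (fps_of_poly (pcompose p [:z, 1:]))"

lemma fps_of_poly_has_fps_expansion:
  fixes p :: "complex poly"
  shows "poly p has_fps_expansion fps_of_poly p"
  by (simp add: has_fps_expansion_def)

lemma germ_poly_has_laurent_expansion: "(\<lambda>w. poly p (z + w)) has_laurent_expansion germ_poly z p"
proof -
  have "poly (pcompose p [:z, 1:]) = (\<lambda>w. poly p (z + w))"
    by (simp add: fun_eq_iff poly_pcompose)
  with has_laurent_expansion_fps[OF fps_of_poly_has_fps_expansion, of "pcompose p [:z, 1:]"]
  show ?thesis by (simp add: germ_poly_def)
qed

lemma germ_poly_add: "germ_poly z (p + q) = germ_poly z p + germ_poly z q"
  by (simp add: germ_poly_def pcompose_add fps_of_poly_add)

lemma germ_poly_mult: "germ_poly z (p * q) = germ_poly z p * germ_poly z q"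
  by (simp add: germ_poly_def pcompose_mult fps_of_poly_mult fls_times_fps_to_fls)

lemma germ_poly_const: "germ_poly z [:c:] = fls_const c"
  by (simp add: germ_poly_def fps_of_poly_const)

lemma germ_poly_eq_0_iff: "germ_poly z p = 0 \<longleftrightarrow> p = 0"
  using fps_of_poly_eq_iff[of "pcompose p [:z, 1:]" 0]
  by (simp add: germ_poly_def pcompose_eq_0_iff)

lemma fls_deriv_germ_poly: "fls_deriv (germ_poly z p) = germ_poly z (pderiv p)"
  by (simp add: germ_poly_def fls_deriv_fps_to_fls pderiv_pcompose pderiv_pCons flip: fps_of_poly_pderiv)

text \<open>
  A meromorphic function on the strip is represented by the sequence of its Laurent expansions at
  the points \<open>z + k\<close>.  The index \<open>k\<close> runs over all integers to make the shift injective.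
\<close>

lemma delta_sigma_module_germs:
  "delta_sigma_module (\<lambda>p v (k::int). germ_poly (z + of_int k) p * v k)
     (\<lambda>v k. fls_deriv (v k)) (\<lambda>v k. v (k + 1))"
proof unfold_locales
  show "p = 0 \<or> v = 0" if "(\<lambda>k. germ_poly (z + of_int k) p * v k) = 0" for p v
  proof (cases "p = 0")
    case False
    have "v k = 0" for k
      using fun_cong[OF that, of k] False by (simp add: germ_poly_eq_0_iff)
    thus ?thesis by auto
  qed simp
  show "v = 0" if "(\<lambda>k. v (k + 1)) = 0" for v :: "int \<Rightarrow> complex fls"
  proof
    fix k show "v k = 0 k" using fun_cong[OF that, of "k - 1"] by simp
  qed
  show "(\<lambda>k. germ_poly (z + of_int (k + 1)) p * v (k + 1)) =
        (\<lambda>k. germ_poly (z + of_int k) (pcompose p [:1, 1:]) * v (k + 1))" for p v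
    by (simp add: germ_poly_def pcompose_pCons add_ac flip: pcompose_assoc)
qed (auto simp: fun_eq_iff algebra_simps germ_poly_add germ_poly_mult fls_deriv_germ_poly
        germ_poly_const[of _ 1, simplified one_pCons[symmetric]])

section \<open>Exponential polynomials in a local coordinate\<close>

definition exp_term :: "complex poly \<Rightarrow> complex \<Rightarrow> complex fls" where
  "exp_term p \<alpha> = fps_to_fls (fps_of_poly p * fps_exp \<alpha>)"

definition exp_polys :: "complex fls set" where
  "exp_polys = {v. \<exists>(t::nat) p \<alpha>. v = (\<Sum>i=1..t. exp_term (p i) (\<alpha> i))}"

lemma fls_deriv_exp_term: "fls_deriv (exp_term p \<alpha>) = exp_term (pderiv p + smult \<alpha> p) \<alpha>"
  by (simp add: exp_term_def fls_deriv_fps_to_fls fps_of_poly_add fps_of_poly_pderiv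
       fps_of_poly_smult algebra_simps)

lemma exp_term_diff: "exp_term p \<alpha> - fls_const c * exp_term q \<alpha> = exp_term (p - smult c q) \<alpha>"
  by (simp add: exp_term_def fls_times_fps_to_fls fps_of_poly_diff fps_of_poly_smult algebra_simps)

lemma exp_term_has_laurent_expansion:
  "(\<lambda>w. poly p w * exp (\<alpha> * w)) has_laurent_expansion exp_term p \<alpha>"
  unfolding exp_term_def
  by (intro has_laurent_expansion_fps fps_expansion_intros fps_of_poly_has_fps_expansion)

text \<open>A particular solution is found term by term, each exponential turning the equation into
  one for polynomials with \<open>a\<close> replaced by \<open>\<alpha> i - a\<close>. The remainder
  solves w' = a w, and the integrating factor exp(-a x) makes it a multiple of exp(a x).\<close>

lemma exp_polys_of_deriv:
  assumes "fls_deriv v - fls_const a * v \<in> exp_polys"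
  shows "v \<in> exp_polys"
proof -
  obtain t p \<alpha> where 1: "fls_deriv v - fls_const a * v = (\<Sum>i=1..t::nat. exp_term (p i) (\<alpha> i))"
    using assms by (auto simp: exp_polys_def)
  have "\<forall>i. \<exists>q. pderiv q + smult (\<alpha> i - a) q = p i" using ex_pderiv_add_smult_eq by blast
  then obtain q where q: "\<And>i. pderiv (q i) + smult (\<alpha> i - a) (q i) = p i" by metis
  define w where "w = v - (\<Sum>i=1..t. exp_term (q i) (\<alpha> i))"
  have "fls_deriv (exp_term (q i) (\<alpha> i)) - fls_const a * exp_term (q i) (\<alpha> i) = exp_term (p i) (\<alpha> i)" for i
    unfolding fls_deriv_exp_term exp_term_diff by (simp add: algebra_simps smult_diff_left flip: q)
  moreover have "fls_deriv w - fls_const a * w = fls_deriv v - fls_const a * v -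
      (\<Sum>i=1..t. fls_deriv (exp_term (q i) (\<alpha> i)) - fls_const a * exp_term (q i) (\<alpha> i))"
    by (simp add: w_def fls_deriv_sum sum_distrib_left right_diff_distrib sum_subtractf)
  ultimately have "fls_deriv w - fls_const a * w = 0" using 1 by simp
  hence w: "fls_deriv w = fls_const a * w" by simp
  have E: "fps_to_fls (fps_exp (-a)) * fps_to_fls (fps_exp a) = 1"
    by (simp flip: fls_times_fps_to_fls add: fps_exp_add_mult[symmetric])
  have "fls_deriv (fps_to_fls (fps_exp (-a)) * w) = 0"
    by (simp add: w fls_deriv_fps_to_fls fls_times_fps_to_fls)
  then obtain c where "fps_to_fls (fps_exp (-a)) * w = fls_const c"
    unfolding fls_deriv_eq_0_iff by blast
  moreover have "w = fps_to_fls (fps_exp (-a)) * fps_to_fls (fps_exp a) * w" by (simp add: E)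
  hence "w = fps_to_fls (fps_exp (-a)) * w * fps_to_fls (fps_exp a)" by (simp only: mult_ac)
  ultimately have "w = fls_const c * fps_to_fls (fps_exp a)" by simp
  also have "\<dots> = exp_term [:c:] a"
    by (simp add: exp_term_def fls_times_fps_to_fls fps_of_poly_const)
  finally have "v = (\<Sum>i=1..t. exp_term (q i) (\<alpha> i)) + exp_term [:c:] a"
    by (simp add: w_def algebra_simps)
  also have "\<dots> = (\<Sum>i=1..Suc t. exp_term ((q(Suc t := [:c:])) i) ((\<alpha>(Suc t := a)) i))"
    by (simp add: sum.nat_ivl_Suc')
  finally show ?thesis unfolding exp_polys_def by blast
qed

section \<open>Passing between functions and their germs\<close>

lemma deriv_translate: "deriv (\<lambda>w. f (z + w)) = (\<lambda>w. deriv f (z + w :: complex))"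
  by (simp add: deriv_def fun_eq_iff DERIV_shift[symmetric] add.commute)

lemma higher_deriv_has_laurent_expansion:
  assumes "(\<lambda>w. f (z + w)) has_laurent_expansion F"
  shows "(\<lambda>w. (deriv ^^ i) f (z + w)) has_laurent_expansion (fls_deriv ^^ i) F"
proof (induction i)
  case (Suc i)
  from has_laurent_expansion_deriv[OF this] show ?case by (simp add: deriv_translate)
qed (use assms in simp)

lemma cosparse_poly_nonzero:
  fixes q :: "complex poly"
  assumes "q \<noteq> 0" shows "\<forall>\<^sub>\<approx>x\<in>A. poly q x \<noteq> 0"
  unfolding eventually_cosparse using poly_roots_finite[OF assms] by (auto intro: finite_imp_sparse)

lemma clear_denominators_cosparse:
  fixes w :: "nat \<Rightarrow> complex \<Rightarrow> complex"
  assumes "\<forall>\<^sub>\<approx>x\<in>X. w n x + (\<Sum>i<n. ratfun_eval (a i) x * w i x) = 0"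
  shows "\<exists>A. A n \<noteq> 0 \<and> (\<forall>\<^sub>\<approx>x\<in>X. (\<Sum>i\<le>n. poly (A i) x * w i x) = 0)"
proof -
  obtain p q where pq: "q \<noteq> 0" "\<And>i. i < n \<Longrightarrow> a i = Fract (p i) q"
    using ratfun_common_denominator[of n a] by blast
  define A where "A = (\<lambda>i. if i < n then p i else q)"
  from assms cosparse_poly_nonzero[OF pq(1)]
  have "\<forall>\<^sub>\<approx>x\<in>X. (\<Sum>i\<le>n. poly (A i) x * w i x) = 0"
  proof eventually_elim
    case (elim x)
    have "(\<Sum>i\<le>n. poly (A i) x * w i x) = poly q x * w n x + (\<Sum>i<n. poly (p i) x * w i x)"
      by (simp add: lessThan_Suc_atMost[symmetric] A_def)
    also have "(\<Sum>i<n. poly (p i) x * w i x) = poly q x * (\<Sum>i<n. ratfun_eval (a i) x * w i x)"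
      unfolding sum_distrib_left using elim(2) by (intro sum.cong) (simp_all add: pq ratfun_eval_Fract)
    also have "poly q x * w n x + \<dots> = 0" using elim(1) by (simp flip: distrib_left)
    finally show ?case .
  qed
  thus ?thesis using pq(1) by (intro exI[of _ A]) (simp add: A_def)
qed

text \<open>A relation off a sparse set holds on a punctured neighbourhood of each point of
  \<open>X\<close>, hence exactly between the Laurent series there.\<close>

lemma laurent_expansion_of_relation:
  fixes W :: "nat \<Rightarrow> complex fls"
  assumes "\<forall>\<^sub>\<approx>x\<in>X. (\<Sum>i\<le>n. poly (A i) x * w i x) = 0" "z \<in> X"
      and "\<And>i. (\<lambda>x. w i (z + x)) has_laurent_expansion W i"
  shows "(\<Sum>i\<le>n. germ_poly z (A i) * W i) = 0"
proof -
  have ev: "eventually (\<lambda>x. (\<Sum>i\<le>n. poly (A i) (z + x) * w i (z + x)) = 0) (at 0)"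
    using eventually_cosparse_imp_eventually_at[OF assms(1,2), of UNIV]
    by (subst (asm) eventually_at_to_0) (simp add: add.commute)
  have "(\<lambda>x. \<Sum>i\<le>n. poly (A i) (z + x) * w i (z + x)) has_laurent_expansion
          (\<Sum>i\<le>n. germ_poly z (A i) * W i)"
    by (intro laurent_expansion_intros germ_poly_has_laurent_expansion assms(3))
  also have "(\<lambda>x. \<Sum>i\<le>n. poly (A i) (z + x) * w i (z + x)) has_laurent_expansion
               (\<Sum>i\<le>n. germ_poly z (A i) * W i) \<longleftrightarrow>
             (\<lambda>_. 0) has_laurent_expansion (\<Sum>i\<le>n. germ_poly z (A i) * W i)"
    using ev by (intro has_laurent_expansion_cong) simp_all
  finally show ?thesis by (rule zero_has_laurent_expansion_imp_eq_0)
qed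

lemma fun_shift_pow: "(fun_shift ^^ j) f x = f (x + of_nat j)"
  by (induction j arbitrary: x) (simp_all add: fun_shift_def add_ac)

lemma sum_fun_apply: "(sum f A) x = (\<Sum>i\<in>A. f i x)"
  by (induction A rule: infinite_finite_induct) auto

theorem meromorphic_exp_poly:
  assumes "m < M" and f: "f meromorphic_on horizontal_strip m M"
      and a: "\<forall>\<^sub>\<approx>x\<in>horizontal_strip m M.
           (deriv ^^ n) f x + (\<Sum>i<n. ratfun_eval (a i) x * (deriv ^^ i) f x) = 0"
      and b: "\<forall>\<^sub>\<approx>x\<in>horizontal_strip m M.
           (fun_shift ^^ l) f x + (\<Sum>i<l. ratfun_eval (b i) x * (fun_shift ^^ i) f x) = 0"
  shows "\<exists>(t :: nat) (\<alpha> :: nat \<Rightarrow> complex) (r :: nat \<Rightarrow> ratfun).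
           \<forall>\<^sub>\<approx>x\<in>horizontal_strip m M. f x = (\<Sum>i=1..t. ratfun_eval (r i) x * exp (\<alpha> i * x))"
proof -
  define X where "X = horizontal_strip m M"
  have X_eq: "X = {z. m < Im z} \<inter> {z. Im z < M}" by (auto simp: X_def horizontal_strip_def)
  have X: "open X" "connected X"
  proof -
    show "open X" unfolding X_eq by (intro open_Int open_halfspace_Im_gt open_halfspace_Im_lt)
    show "connected X" unfolding X_eq
      by (intro convex_connected convex_Int convex_halfspace_Im_gt convex_halfspace_Im_lt)
  qed
  \<comment> \<open>A point on the middle line; integer translations are horizontal and stay in the
    strip.\<close>
  define z where "z = Complex 0 ((m + M) / 2)"
  have z: "z + of_int k \<in> X" for k
    using assms(1) by (simp add: X_eq z_def)
  obtain A where A: "A n \<noteq> 0" "\<forall>\<^sub>\<approx>x\<in>X. (\<Sum>i\<le>n. poly (A i) x * (deriv ^^ i) f x) = 0"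
    using clear_denominators_cosparse[OF a] unfolding X_def by blast
  obtain B where B: "B l \<noteq> 0" "\<forall>\<^sub>\<approx>x\<in>X. (\<Sum>i\<le>l. poly (B i) x * (fun_shift ^^ i) f x) = 0"
    using clear_denominators_cosparse[OF b] unfolding X_def by blast
  interpret delta_sigma_module "\<lambda>p v (k::int). germ_poly (z + of_int k) p * v k"
    "\<lambda>v k. fls_deriv (v k)" "\<lambda>v k. v (k + 1)"
    by (rule delta_sigma_module_germs)
  define F where "F = (\<lambda>k. laurent_expansion f (z + of_int k))"
  have F: "(\<lambda>w. f (z + of_int k + w)) has_laurent_expansion F k" for k
    unfolding F_def using meromorphic_on_imp_has_laurent_expansion[OF f] z by (simp add: X_def)
  have D_pow: "((\<lambda>v k. fls_deriv (v k)) ^^ i) v k = (fls_deriv ^^ i) (v k)" for i v and k :: int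
    by (induction i) auto
  have S_pow: "((\<lambda>v k. v (k + 1)) ^^ i) v k = v (k + int i)" for i k and v :: "int \<Rightarrow> complex fls"
    by (induction i arbitrary: k) (auto simp: add_ac)
  have "(\<Sum>i\<le>n. germ_poly (z + of_int k) (A i) * (fls_deriv ^^ i) (F k)) = 0" for k
    by (rule laurent_expansion_of_relation[OF A(2) z]) (rule higher_deriv_has_laurent_expansion[OF F])
  hence A': "(\<Sum>i\<le>n. (\<lambda>k. germ_poly (z + of_int k) (A i) * ((\<lambda>v k. fls_deriv (v k)) ^^ i) F k)) = 0"
    by (intro ext) (simp add: sum_fun_apply D_pow)
  have "(\<Sum>i\<le>l. germ_poly (z + of_int k) (B i) * F (k + int i)) = 0" for k
  proof (rule laurent_expansion_of_relation[OF B(2) z])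
    show "(\<lambda>w. (fun_shift ^^ i) f (z + of_int k + w)) has_laurent_expansion F (k + int i)" for i
      using F[of "k + int i"] by (simp add: fun_shift_pow add_ac)
  qed
  hence B': "(\<Sum>i\<le>l. (\<lambda>k. germ_poly (z + of_int k) (B i) * ((\<lambda>v k. v (k + 1)) ^^ i) F k)) = 0"
    by (intro ext) (simp add: sum_fun_apply S_pow)
  obtain h P where hP: "h \<noteq> 0" "P \<noteq> 0" "Dop P (\<lambda>k. germ_poly (z + of_int k) h * F k) = 0"
    using constant_coefficients[OF A(1) A' B(1) B'] .
  \<comment> \<open>The equation now has constant coefficients and involves \<open>D\<close> alone,
    so it can be solved at the single index 0, that is, at \<open>z\<close>.\<close>
  have "(\<lambda>k. germ_poly (z + of_int k) h * F k) \<in> {v. v 0 \<in> exp_polys}"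
  proof (rule op_poly_root_induct[OF const.module_endo_axioms hP(2,3)])
    have "0 \<in> exp_polys" unfolding exp_polys_def
      by (intro CollectI exI[of _ 0] exI[of _ "\<lambda>_. 0"]) simp
    thus "0 \<in> {v :: int \<Rightarrow> _. v 0 \<in> exp_polys}" by simp
  qed (auto simp: germ_poly_const intro: exp_polys_of_deriv)
  then obtain t p \<alpha> where *: "germ_poly z h * F 0 = (\<Sum>i=1..t::nat. exp_term (p i) (\<alpha> i))"
    by (auto simp: exp_polys_def)
  \<comment> \<open>Undoes the local coordinate: p(x - z) exp(alpha (x - z)) is rewritten in x, and
    \<open>h\<close> becomes the denominator.\<close>
  define r where "r = (\<lambda>i. Fract (smult (exp (- \<alpha> i * z)) (pcompose (p i) [:-z, 1:])) h)"
  define g where "g = (\<lambda>x. poly h x * f x - (\<Sum>i=1..t. poly (p i) (x - z) * exp (\<alpha> i * (x - z))))"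
  have "(\<lambda>w. g (z + w)) has_laurent_expansion germ_poly z h * F 0 - (\<Sum>i=1..t. exp_term (p i) (\<alpha> i))"
    unfolding g_def using F[of 0]
    by (auto intro!: laurent_expansion_intros germ_poly_has_laurent_expansion exp_term_has_laurent_expansion)
  hence "(\<lambda>w. g (z + w)) has_laurent_expansion 0" by (simp add: *)
  hence "eventually (\<lambda>w. g (w + z) = 0) (at 0)"
    by (auto simp: has_laurent_expansion_def add.commute elim!: eventually_mono)
  hence ev: "eventually (\<lambda>x. g x = 0) (at z)" by (subst eventually_at_to_0)
  have poly: "(\<lambda>x. poly p (x - c)) meromorphic_on X" for p c
    by (induction p) (auto intro!: meromorphic_intros)
  have "g meromorphic_on X"
    unfolding g_def using f[folded X_def] poly[of h 0]
    by (intro meromorphic_intros poly) (auto intro!: analytic_on_imp_meromorphic_on analytic_intros)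
  \<comment> \<open>Identity theorem: on the connected strip, \<open>g\<close> either vanishes or
    avoids 0 off a sparse set, and it vanishes around \<open>z\<close>.\<close>
  from meromorphic_imp_constant_or_avoid[OF this X, of 0]
  have "\<forall>\<^sub>\<approx>x\<in>X. g x = 0"
  proof
    assume "\<forall>\<^sub>\<approx>x\<in>X. g x \<noteq> 0"
    hence "eventually (\<lambda>x. g x \<noteq> 0) (at z)"
      using eventually_cosparse_imp_eventually_at[of _ X z UNIV] z[of 0] by simp
    with ev have "eventually (\<lambda>_. False) (at z)" by eventually_elim simp
    thus ?thesis by simp
  qed
  with cosparse_poly_nonzero[OF hP(1)] 
  have "\<forall>\<^sub>\<approx>x\<in>X. f x = (\<Sum>i=1..t. ratfun_eval (r i) x * exp (\<alpha> i * x))"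
  proof eventually_elim
    case (elim x)
    have "poly h x * (\<Sum>i=1..t. ratfun_eval (r i) x * exp (\<alpha> i * x)) =
          (\<Sum>i=1..t. poly (p i) (x - z) * exp (\<alpha> i * (x - z)))"
      unfolding sum_distrib_left using elim(1)
      by (intro sum.cong refl)
         (simp add: r_def ratfun_eval_Fract poly_pcompose algebra_simps flip: exp_add)
    also have "\<dots> = poly h x * f x" using elim(2) by (simp add: g_def)
    finally show ?case using elim(1) by simp
  qed
  thus ?thesis unfolding X_def by blast
qed

section \<open>Equations for exponential polynomials\<close>

text \<open>T - c is nilpotent in bounded degree. The alternative \<open>= 0\<close> in
  \<open>lower\<close> is there for constants, whose degree cannot drop.\<close>

lemma op_poly_degree_lowering:
  fixes T :: "complex poly \<Rightarrow> complex poly"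
  assumes "module_endo smult T"
      and lower: "\<And>p. T p - smult c p = 0 \<or> degree (T p - smult c p) < degree p"
  shows "op_poly smult T ([:-c, 1:] ^ Suc (degree p)) p = 0"
proof -
  interpret module_endo smult T by fact
  have "op_poly smult T ([:-c, 1:] ^ n) p = 0" if "p = 0 \<or> degree p < n" for n p
    using that
  proof (induction n arbitrary: p)
    case 0
    thus ?case by (simp add: op_poly_1)
  next
    case (Suc n)
    have "op_poly smult T [:-c, 1:] p = T p - smult c p"
      by (simp add: op_poly_linear)
    moreover have "op_poly smult T ([:-c, 1:] ^ n) (T p - smult c p) = 0"
      using Suc.prems lower[of p] by (intro Suc.IH) (auto simp: T.zero)
    ultimately show ?case
      by (simp only: power_Suc2 op_poly_mult)
  qed
  thus ?thesis by blast
qed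

lemma ex_common_annihilator:
  fixes T :: "'i \<Rightarrow> complex poly \<Rightarrow> complex poly"
  assumes "finite I" and T: "\<And>i. module_endo smult (T i)"
      and lower: "\<And>i p. T i p - smult (c i) p = 0 \<or> degree (T i p - smult (c i) p) < degree p"
  obtains P where "degree P > 0" "\<And>i. i \<in> I \<Longrightarrow> op_poly smult (T i) P (p i) = 0"
proof -
  define Q where "Q = (\<lambda>i. [:- c i, 1:] ^ Suc (degree (p i)))"
  \<comment> \<open>The factor \<open>[:0, 1:]\<close> keeps the degree positive even when
    \<open>I\<close> is empty, since equations of positive order are wanted.\<close>
  define P where "P = [:0, 1:] * (\<Prod>i\<in>I. Q i)"
  have "(\<Prod>i\<in>I. Q i) \<noteq> 0" using assms(1) by (simp add: Q_def del: power_Suc)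
  hence "degree P > 0" unfolding P_def by (subst degree_mult_eq) auto
  moreover have "op_poly smult (T i) P (p i) = 0" if "i \<in> I" for i
  proof -
    interpret module_endo smult "T i" by (rule T)
    have "Q i dvd P" unfolding P_def using assms(1) that by (intro dvd_mult dvd_prodI)
    then obtain R where "P = R * Q i" by (metis dvd_def mult.commute)
    thus ?thesis using op_poly_degree_lowering[OF T[of i] lower, of "p i"]
      by (simp only: op_poly_mult Q_def module.scale_zero_right[OF module_op_poly])
  qed
  ultimately show ?thesis using that by blast
qed

lemma divide_leading_coefficient:
  fixes w :: "nat \<Rightarrow> complex \<Rightarrow> complex"
  assumes "A n \<noteq> 0" "\<forall>\<^sub>\<approx>x\<in>X. (\<Sum>i\<le>n. poly (A i) x * w i x) = 0"
  shows "\<exists>a. \<forall>\<^sub>\<approx>x\<in>X. w n x + (\<Sum>i<n. ratfun_eval (a i) x * w i x) = 0"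
proof (intro exI)
  from cosparse_poly_nonzero[OF assms(1)] assms(2)
  show "\<forall>\<^sub>\<approx>x\<in>X. w n x + (\<Sum>i<n. ratfun_eval (Fract (A i) (A n)) x * w i x) = 0"
  proof eventually_elim
    case (elim x)
    have "poly (A n) x * (w n x + (\<Sum>i<n. ratfun_eval (Fract (A i) (A n)) x * w i x)) =
          poly (A n) x * w n x + (\<Sum>i<n. poly (A i) x * w i x)"
      unfolding distrib_left sum_distrib_left using elim(1)
      by (intro arg_cong2[of _ _ _ _ "(+)"] refl sum.cong) (simp_all add: ratfun_eval_Fract)
    also have "\<dots> = 0" using elim(2) by (simp add: lessThan_Suc_atMost[symmetric] add.commute)
    finally show ?case using elim(1) by simp
  qed
qed

lemma deriv_exp_poly:
  fixes p :: "'i \<Rightarrow> complex poly"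
  shows "deriv (\<lambda>x. \<Sum>i\<in>I. poly (p i) x * exp (\<alpha> i * x)) =
         (\<lambda>x. \<Sum>i\<in>I. poly (pderiv (p i) + smult (\<alpha> i) (p i)) x * exp (\<alpha> i * x))"
proof
  fix x
  show "deriv (\<lambda>x. \<Sum>i\<in>I. poly (p i) x * exp (\<alpha> i * x)) x =
         (\<Sum>i\<in>I. poly (pderiv (p i) + smult (\<alpha> i) (p i)) x * exp (\<alpha> i * x))"
    by (rule DERIV_imp_deriv) (auto intro!: derivative_eq_intros sum.cong simp: algebra_simps)
qed

lemma higher_deriv_poly: "(deriv ^^ n) (poly p) = poly ((pderiv ^^ n) (p :: complex poly))"
proof (induction n)
  case (Suc n)
  have "deriv (poly q) = poly (pderiv q)" for q :: "complex poly"
    by (rule ext, rule DERIV_imp_deriv, rule poly_DERIV)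
  thus ?case using Suc by simp
qed simp

text \<open>Shared by derivative and shift: both keep each exponential and act only on the
  polynomial in front of it, through \<open>T i\<close>.\<close>

lemma op_poly_exp_poly_sum:
  fixes T :: "nat \<Rightarrow> complex poly \<Rightarrow> complex poly" and w :: "nat \<Rightarrow> complex"
  assumes "\<And>k. w k = (\<Sum>i=1..t. poly ((T i ^^ k) (p i)) x * e i)"
      and "\<And>i. i \<in> {1..t} \<Longrightarrow> op_poly smult (T i) P (p i) = 0"
  shows "(\<Sum>k\<le>degree P. coeff P k * w k) = 0"
proof -
  have "(\<Sum>k\<le>degree P. coeff P k * w k) =
        (\<Sum>i=1..t. (\<Sum>k\<le>degree P. coeff P k * poly ((T i ^^ k) (p i)) x) * e i)"
    unfolding assms(1) sum_distrib_left sum_distrib_right by (subst sum.swap) (simp only: mult.assoc)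
  also have "\<dots> = (\<Sum>i=1..t. poly (op_poly smult (T i) P (p i)) x * e i)"
    by (simp add: op_poly_def poly_sum)
  also have "\<dots> = 0" using assms(2) by simp
  finally show ?thesis .
qed

theorem exp_poly_equations:
  fixes f :: "complex \<Rightarrow> complex" and t :: nat
  assumes f: "\<forall>x. f x = (\<Sum>i=1..t. ratfun_eval (r i) x * exp (\<alpha> i * x))"
  shows "\<exists>(n :: nat) (l :: nat) (a :: nat \<Rightarrow> ratfun) (b :: nat \<Rightarrow> ratfun).
           n > 0 \<and> l > 0 \<and>
           (\<forall>\<^sub>\<approx>x.
              (deriv ^^ n) f x + (\<Sum>i<n. ratfun_eval (a i) x * (deriv ^^ i) f x) = 0) \<and>
           (\<forall>\<^sub>\<approx>x.
              (fun_shift ^^ l) f x + (\<Sum>i<l. ratfun_eval (b i) x * (fun_shift ^^ i) f x) = 0)"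
proof -
  \<comment> \<open>\<open>Suc t\<close>, because the sum includes the index \<open>t\<close> while
    the denominators are taken for indices strictly below the bound.\<close>
  obtain p q where pq: "q \<noteq> 0" "\<And>i. i < Suc t \<Longrightarrow> r i = Fract (p i) q"
    using ratfun_common_denominator[of "Suc t" r] by blast
  define g where "g = (\<lambda>x. \<Sum>i=1..t. poly (p i) x * exp (\<alpha> i * x))"
  have fg: "poly q x * f x = g x" if "poly q x \<noteq> 0" for x
    unfolding f[rule_format] g_def sum_distrib_left
    by (intro sum.cong) (use that in \<open>simp_all add: pq ratfun_eval_Fract\<close>)

  have "\<exists>n A. n > 0 \<and> A n \<noteq> 0 \<and> (\<forall>\<^sub>\<approx>x. (\<Sum>i\<le>n. poly (A i) x * (deriv ^^ i) f x) = 0)"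
  proof -
    define T where "T = (\<lambda>i p. pderiv p + smult (\<alpha> i) p)"
    have endo: "module_endo smult (T i)" for i
      by unfold_locales (simp_all add: T_def pderiv_add pderiv_smult smult_add_right smult_add_left mult.commute)
    have "T i p - smult (\<alpha> i) p = 0 \<or> degree (T i p - smult (\<alpha> i) p) < degree p" for i p
      by (cases "degree p = 0") (simp_all add: T_def degree_pderiv pderiv_eq_0_iff)
    then obtain P where P: "degree P > 0" "\<And>i. i \<in> {1..t} \<Longrightarrow> op_poly smult (T i) P (p i) = 0"
      using ex_common_annihilator[of "{1..t}" T \<alpha> p, OF _ endo] by blast
    have g_deriv: "(deriv ^^ k) g x = (\<Sum>i=1..t. poly ((T i ^^ k) (p i)) x * exp (\<alpha> i * x))" for k x
    proof -
      have "(deriv ^^ k) g = (\<lambda>x. \<Sum>i=1..t. poly ((T i ^^ k) (p i)) x * exp (\<alpha> i * x))"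
        by (induction k) (simp_all add: g_def deriv_exp_poly T_def)
      thus ?thesis by simp
    qed
    define n where "n = degree P"
    have rel: "(\<Sum>k\<le>n. coeff P k * (deriv ^^ k) g x) = 0" for x
      unfolding n_def by (rule op_poly_exp_poly_sum[OF g_deriv P(2)])
    \<comment> \<open>The coefficients of the derivatives of \<open>f\<close> when P(D)(q f) = 0 is
      expanded by the Leibniz rule. Only \<open>k = n\<close> contributes to the leading
      one.\<close>
    define A where "A = (\<lambda>i. \<Sum>k\<le>n. smult (coeff P k * of_nat (k choose i)) ((pderiv ^^ (k - i)) q))"
    have "A n = smult (coeff P n) q"
    proof -
      have "A n = (\<Sum>k\<in>{n}. smult (coeff P k * of_nat (k choose n)) ((pderiv ^^ (k - n)) q))"
        unfolding A_def by (rule sum.mono_neutral_right) (auto simp: not_less_iff_gr_or_eq intro!: binomial_eq_0)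
      thus ?thesis by simp
    qed
    moreover have "coeff P n \<noteq> 0" using P(1) by (auto simp: n_def)
    ultimately have "A n \<noteq> 0" using pq(1) by simp
    \<comment> \<open>The identity q f = g is available only off the zeros of \<open>q\<close>,
      while the Leibniz rule needs it on an open set on which \<open>f\<close> is
      holomorphic.\<close>
    define U where "U = {x. poly q x \<noteq> 0}"
    have U: "open U" unfolding U_def by (intro open_Collect_neq continuous_intros)
    have g_holo: "g holomorphic_on U" unfolding g_def by (intro holomorphic_intros)
    have f_holo: "f holomorphic_on U"
    proof (rule holomorphic_transform)
      show "(\<lambda>x. g x / poly q x) holomorphic_on U"
        by (intro holomorphic_intros g_holo) (auto simp: U_def)
      show "g x / poly q x = f x" if "x \<in> U" for x using fg[of x] that by (simp add: U_def field_simps)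
    qed
    have "(\<Sum>i\<le>n. poly (A i) x * (deriv ^^ i) f x) = 0" if "poly q x \<noteq> 0" for x
    proof -
      have x: "x \<in> U" using that by (simp add: U_def)
      have g: "(deriv ^^ k) g x = (\<Sum>i\<le>n. of_nat (k choose i) * (deriv ^^ i) f x * poly ((pderiv ^^ (k - i)) q) x)"
        if "k \<le> n" for k
      proof -
        have "(deriv ^^ k) g x = (deriv ^^ k) (\<lambda>x. f x * poly q x) x"
          by (rule higher_deriv_transform_within_open[OF _ _ U x])
             (use fg in \<open>auto simp: U_def mult.commute intro!: holomorphic_intros g_holo[unfolded U_def] f_holo[unfolded U_def]\<close>)
        also have "\<dots> = (\<Sum>i=0..k. of_nat (k choose i) * (deriv ^^ i) f x * (deriv ^^ (k - i)) (poly q) x)"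
          by (rule higher_deriv_mult[OF f_holo _ U x]) (intro holomorphic_intros)
        also have "\<dots> = (\<Sum>i\<le>n. of_nat (k choose i) * (deriv ^^ i) f x * poly ((pderiv ^^ (k - i)) q) x)"
          unfolding higher_deriv_poly using that by (intro sum.mono_neutral_left) (auto simp: binomial_eq_0)
        finally show ?thesis .
      qed
      have "0 = (\<Sum>k\<le>n. coeff P k * (deriv ^^ k) g x)" by (simp add: rel)
      also have "\<dots> = (\<Sum>k\<le>n. \<Sum>i\<le>n. coeff P k * (of_nat (k choose i) * (deriv ^^ i) f x * poly ((pderiv ^^ (k - i)) q) x))"
        by (simp add: g sum_distrib_left)
      also have "\<dots> = (\<Sum>i\<le>n. poly (A i) x * (deriv ^^ i) f x)"
        by (subst sum.swap) (simp add: A_def poly_sum sum_distrib_left sum_distrib_right mult_ac)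
      finally show ?thesis by simp
    qed
    with cosparse_poly_nonzero[OF pq(1), of UNIV]
    have "\<forall>\<^sub>\<approx>x. (\<Sum>i\<le>n. poly (A i) x * (deriv ^^ i) f x) = 0" by (auto elim!: eventually_mono)
    with \<open>A n \<noteq> 0\<close> P(1) show ?thesis unfolding n_def by blast
  qed
  then obtain n A where n: "n > 0" "A n \<noteq> 0" "\<forall>\<^sub>\<approx>x. (\<Sum>i\<le>n. poly (A i) x * (deriv ^^ i) f x) = 0"
    by blast

  have "\<exists>l B. l > 0 \<and> B l \<noteq> 0 \<and> (\<forall>\<^sub>\<approx>x. (\<Sum>i\<le>l. poly (B i) x * (fun_shift ^^ i) f x) = 0)"
  proof -
    \<comment> \<open>The effect of x -> x + 1 on the polynomial in front of exp(alpha x), the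
      constant exp(alpha) being moved to it.\<close>
    define T where "T = (\<lambda>i p. smult (exp (\<alpha> i)) (pcompose p [:1, 1:]))"
    have endo: "module_endo smult (T i)" for i
      by unfold_locales (simp_all add: T_def pcompose_add pcompose_smult smult_add_right smult_add_left mult.commute)
    have lower: "T i p - smult (exp (\<alpha> i)) p = 0 \<or> degree (T i p - smult (exp (\<alpha> i)) p) < degree p" for i p
    proof (cases "T i p - smult (exp (\<alpha> i)) p = 0")
      case False
      \<comment> \<open>A finite difference: the leading coefficients cancel, so the degree
        drops.\<close>
      define s where "s = pcompose p [:1, 1:] - p"
      have Ts: "T i p - smult (exp (\<alpha> i)) p = smult (exp (\<alpha> i)) s"
        by (simp add: T_def s_def smult_diff_right)
      have "degree s \<le> degree p" unfolding s_def by (intro degree_diff_le) (simp_all add: degree_pcompose)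
      moreover have "coeff s (degree p) = 0"
        using lead_coeff_comp[of "[:1, 1:]" p] by (simp add: s_def degree_pcompose)
      ultimately show ?thesis using False unfolding Ts
        by (auto simp: le_less) (metis leading_coeff_0_iff)
    qed simp
    then obtain P where P: "degree P > 0" "\<And>i. i \<in> {1..t} \<Longrightarrow> op_poly smult (T i) P (p i) = 0"
      using ex_common_annihilator[of "{1..t}" T "\<lambda>i. exp (\<alpha> i)" p, OF _ endo] by blast
    have T_pow: "poly ((T i ^^ k) u) x * exp (\<alpha> i * x) = poly u (x + of_nat k) * exp (\<alpha> i * (x + of_nat k))" for i k u x
      by (induction k arbitrary: x u)
         (simp_all add: T_def funpow_swap1 poly_pcompose algebra_simps exp_add)
    have g_shift: "g (x + of_nat k) = (\<Sum>i=1..t. poly ((T i ^^ k) (p i)) x * exp (\<alpha> i * x))" for k x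
      unfolding T_pow g_def ..
    define l where "l = degree P"
    have rel: "(\<Sum>k\<le>l. coeff P k * g (x + of_nat k)) = 0" for x
      unfolding l_def by (rule op_poly_exp_poly_sum[OF g_shift P(2)])
    define B where "B = (\<lambda>k. smult (coeff P k) (pcompose q [:of_nat k, 1:]))"
    have "coeff P l \<noteq> 0" using P(1) by (auto simp: l_def)
    hence "B l \<noteq> 0" using pq(1) by (simp add: B_def pcompose_eq_0_iff)
    moreover have "\<forall>\<^sub>\<approx>x. (\<Sum>i\<le>l. poly (B i) x * (fun_shift ^^ i) f x) = 0"
    proof -
      \<comment> \<open>Excludes the zeros of \<open>q\<close> at all arguments x, ..., x + l, so
        that q f = g may be used at each of them.\<close>
      define R where "R = (\<Prod>k\<le>l. pcompose q [:of_nat k, 1:])"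
      have "R \<noteq> 0" using pq(1) by (simp add: R_def pcompose_eq_0_iff)
      from cosparse_poly_nonzero[OF this, of UNIV] show ?thesis
      proof eventually_elim
        case (elim x)
        hence nz: "poly q (x + of_nat k) \<noteq> 0" if "k \<le> l" for k
          using that by (auto simp: R_def poly_prod poly_pcompose add.commute)
        have "(\<Sum>i\<le>l. poly (B i) x * (fun_shift ^^ i) f x) = (\<Sum>k\<le>l. coeff P k * g (x + of_nat k))"
          by (intro sum.cong refl) (simp add: B_def poly_pcompose fun_shift_pow fg[OF nz, symmetric] add.commute)
        thus ?case by (simp add: rel)
      qed
    qed
    ultimately show ?thesis using P(1) unfolding l_def by blast
  qed
  then obtain l B where l: "l > 0" "B l \<noteq> 0" "\<forall>\<^sub>\<approx>x. (\<Sum>i\<le>l. poly (B i) x * (fun_shift ^^ i) f x) = 0"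
    by blast
  from divide_leading_coefficient[OF n(2,3)] divide_leading_coefficient[OF l(2,3)] n(1) l(1)
  show ?thesis by blast
qed

theorem corollary5:
  shows
    "(\<forall>(m :: real) (M :: real) (f :: complex \<Rightarrow> complex) (n :: nat) (l :: nat)
        (a :: nat \<Rightarrow> ratfun) (b :: nat \<Rightarrow> ratfun).
        m < M \<longrightarrow>
        f meromorphic_on horizontal_strip m M \<longrightarrow>
        (\<forall>\<^sub>\<approx>x\<in>horizontal_strip m M.
           (deriv ^^ n) f x + (\<Sum>i<n. ratfun_eval (a i) x * (deriv ^^ i) f x) = 0) \<longrightarrow>
        (\<forall>\<^sub>\<approx>x\<in>horizontal_strip m M.
           (fun_shift ^^ l) f x + (\<Sum>i<l. ratfun_eval (b i) x * (fun_shift ^^ i) f x) = 0) \<longrightarrow>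
        (\<exists>(t :: nat) (\<alpha> :: nat \<Rightarrow> complex) (r :: nat \<Rightarrow> ratfun).
           \<forall>\<^sub>\<approx>x\<in>horizontal_strip m M. f x = (\<Sum>i=1..t. ratfun_eval (r i) x * exp (\<alpha> i * x))))
     \<and>
     (\<forall>(t :: nat) (\<alpha> :: nat \<Rightarrow> complex) (r :: nat \<Rightarrow> ratfun) (f :: complex \<Rightarrow> complex).
        (\<forall>x. f x = (\<Sum>i=1..t. ratfun_eval (r i) x * exp (\<alpha> i * x))) \<longrightarrow>
        (\<exists>(n :: nat) (l :: nat) (a :: nat \<Rightarrow> ratfun) (b :: nat \<Rightarrow> ratfun).
           n > 0 \<and> l > 0 \<and>
           (\<forall>\<^sub>\<approx>x.
              (deriv ^^ n) f x + (\<Sum>i<n. ratfun_eval (a i) x * (deriv ^^ i) f x) = 0) \<and>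
           (\<forall>\<^sub>\<approx>x.
              (fun_shift ^^ l) f x + (\<Sum>i<l. ratfun_eval (b i) x * (fun_shift ^^ i) f x) = 0)))
     \<and>
     (\<forall>(f :: complex fls) (n :: nat) (l :: nat) (a :: nat \<Rightarrow> ratfun) (b :: nat \<Rightarrow> ratfun).
        (fls_delta ^^ n) f + (\<Sum>i<n. ratfun_expansion (a i) * (fls_delta ^^ i) f) = 0 \<longrightarrow>
        (fls_sigma ^^ l) f + (\<Sum>i<l. ratfun_expansion (b i) * (fls_sigma ^^ i) f) = 0 \<longrightarrow>
        f \<in> range ratfun_expansion)"
proof (intro conjI allI impI)
  show "\<exists>(t :: nat) (\<alpha> :: nat \<Rightarrow> complex) (r :: nat \<Rightarrow> ratfun).
          \<forall>\<^sub>\<approx>x\<in>horizontal_strip m M. f x = (\<Sum>i=1..t. ratfun_eval (r i) x * exp (\<alpha> i * x))"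
    if "m < M" "f meromorphic_on horizontal_strip m M"
       "\<forall>\<^sub>\<approx>x\<in>horizontal_strip m M.
          (deriv ^^ n) f x + (\<Sum>i<n. ratfun_eval (a i) x * (deriv ^^ i) f x) = 0"
       "\<forall>\<^sub>\<approx>x\<in>horizontal_strip m M.
          (fun_shift ^^ l) f x + (\<Sum>i<l. ratfun_eval (b i) x * (fun_shift ^^ i) f x) = 0"
    for m M f n l a b
    using that by (rule meromorphic_exp_poly)
qed (fact exp_poly_equations fls_rational)+

end
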